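(* Let $p\neq 0$ and let $F:(t_1,t_2)\times(s_1,s_2)\to \mathrm{Sol}(3)$ be an orthogonal ruled surface with ruling geodesics $s\mapsto F(t,s)$. Then the frames $F_t=dF(\partial_t)$ and $F_s=dF(\partial_s)$ must have one of the two following forms. (1) $F_s=u_1$ and $$F_t=e^{-\frac{p}{\varepsilon}s}\left(a_1(t)\cos\left(\tfrac{s}{\varepsilon}\right)+a_2(t)\sin\left(\tfrac{s}{\varepsilon}\right)\right)u_2+e^{-\frac{p}{\varepsilon}s}\left(a_2(t)\cos\left(\tfrac{s}{\varepsilon}\right)-a_1(t)\sin\left(\tfrac{s}{\varepsilon}\right)\right)u_3,$$ where $a_1(t),a_2(t)$ are arbitrary smooth functions. (2) $F_s=-\tanh(\omega)\,u_1+\operatorname{sech}(\omega)\cos(\sigma)\,u_2+\operatorname{sech}(\omega)\sin(\sigma)\,u_3$ and $F_t=F_t^1u_1+F_t^2u_2+F_t^3u_3$ with $$F_t^1=-b_2-\frac{\varepsilon}{p}c_1'\tanh(\omega),$$ $$F_t^2=\left(-b_2\sinh(\omega)-\frac{\varepsilon}{p}c_1'\sinh(\omega)\tanh(\omega)\right)\cos(\sigma)-\left(-b_1\cosh(\omega)+\frac{\varepsilon\theta'-b_2}{p}\sinh(\omega)\right)\sin(\sigma),$$ $$F_t^3=\left(-b_1\cosh(\omega)+\frac{\varepsilon\theta'-b_2}{p}\sinh(\omega)\right)\cos(\sigma)-\left(b_2\sinh(\omega)+\frac{\varepsilon}{p}c_1'\sinh(\omega)\tanh(\omega)\right)\sin(\sigma),$$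 where $\omega=\frac{p}{\varepsilon}s+c_1(t)$, $\sigma=\frac1p\log\left(\cosh\left(\frac{p}{\varepsilon}s+c_1(t)\right)\right)+\theta(t)$, and $c_1(t),\theta(t),b_1(t),b_2(t)$ are arbitrary smooth functions (primes denote $d/dt$).
   Context: Fix $p\in\mathbb{R}$ and $\varepsilon,\alpha>0$. $\mathrm{Sol}(3)$ denotes the Lie group $\mathbb{R}^3$ with product $(x,y,z)\cdot(x',y',z')=(x+x',\ \exp(Ax)(y',z')+(y,z))$, where $A=\begin{pmatrix}p&-1\\1&p\end{pmatrix}$. Its left-invariant frame $e_1,e_2,e_3$ (equal to the standard basis at the identity) satisfies $[e_1,e_2]=pe_2+e_3$, $[e_1,e_3]=-e_2+pe_3$, $[e_2,e_3]=0$. With dual coframe $\lambda^1,\lambda^2,\lambda^3$, the group carries the left-invariant metric $g=\varepsilon^2(\lambda^1)^2+\alpha^2((\lambda^2)^2+(\lambda^3)^2)$. The frame $u_1=\frac1\varepsilon e_1$, $u_2=\frac1\alpha e_2$, $u_3=\frac1\alpha e_3$ is orthonormal. A ruled surface is a smooth map $F(t,s)=\exp_{\gamma(t)}(sX(t))$ on $(t_1,t_2)\times(s_1,s_2)$, where $\gamma$ is a smooth curve, $X$ is a nowhere vanishing smooth vector field along $\gamma$, and $\exp$ is the Riemannian exponential map; thus $\nabla_{F_s}F_s=0$, with $F_s=dF(\partial_s)$, $F_t=dF(\partial_t)$ and $\nabla$ the Levi-Civita connection. It is orthogonal if $g(F_t,F_s)=0$ everywhere; then $\|F_s\|_g$ is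 constant.
   Formalization: The forms hold after rescaling s by a constant k (k>0 in (2), k≠0 in (1)), as unit speed and orientation are not assumed, and only on t-intervals whose rulings are all tangent, or all transverse, to u_1; rulings can change type (γ constant, X=cos t u_1+sin t u_2), so no global alternative holds. *)

theory Defs
  imports "HOL-Analysis.Analysis"
begin

text \<open>Smooth (\<open>C\<^sup>\<infinity>\<close>) maps. Only meant for open sets \<open>S\<close>.\<close>

primrec Ck_on :: "nat \<Rightarrow> 'a::real_normed_vector set \<Rightarrow> ('a \<Rightarrow> 'b::real_normed_vector) \<Rightarrow> bool" where
  "Ck_on 0 S f \<longleftrightarrow> continuous_on S f"
| "Ck_on (Suc k) S f \<longleftrightarrow>
     (\<forall>x\<in>S. f differentiable (at x)) \<and> (\<forall>v. Ck_on k S (\<lambda>x. frechet_derivative f (at x) v))"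

definition smooth_on :: "'a::real_normed_vector set \<Rightarrow> ('a \<Rightarrow> 'b::real_normed_vector) \<Rightarrow> bool" where
  "smooth_on S f \<longleftrightarrow> (\<forall>k. Ck_on k S f)"

text \<open>Nonempty open intervals, bounded or not.\<close>

definition open_interval :: "real set \<Rightarrow> bool" where
  "open_interval I \<longleftrightarrow> open I \<and> is_interval I \<and> I \<noteq> {}"


text \<open>
  Riemannian geometry of a metric on \<open>\<real>\<^sup>n\<close>, in the global chart: all tangent spaces are
  identified with \<open>\<real>\<^sup>n\<close>, and \<open>g q v w\<close> is the inner product of \<open>v, w\<close> at the point \<open>q\<close>.
\<close>

type_synonym 'n metric = "real^'n \<Rightarrow> real^'n \<Rightarrow> real^'n \<Rightarrow> real"

definition gram :: "'n::finite metric \<Rightarrow> real^'n \<Rightarrow> real^'n^'n" where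
  "gram g q = (\<chi> i j. g q (axis i 1) (axis j 1))"

definition dgram :: "'n::finite metric \<Rightarrow> 'n \<Rightarrow> 'n \<Rightarrow> 'n \<Rightarrow> real^'n \<Rightarrow> real" where
  "dgram g l i j q = frechet_derivative (\<lambda>r. gram g r $ i $ j) (at q) (axis l 1)"

text \<open>The symbols \<open>\<Gamma>\<^sup>k\<^sub>i\<^sub>j\<close> of the Levi-Civita connection.\<close>

definition christoffel :: "'n::finite metric \<Rightarrow> 'n \<Rightarrow> 'n \<Rightarrow> 'n \<Rightarrow> real^'n \<Rightarrow> real" where
  "christoffel g k i j q =
     (\<Sum>l\<in>UNIV. matrix_inv (gram g q) $ k $ l *
        (dgram g i j l q + dgram g j i l q - dgram g l i j q)) / 2"

text \<open>Covariant derivative along the curve \<open>c\<close> of the vector field \<open>V\<close> along \<open>c\<close>.\<close>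

definition cov_deriv ::
    "'n::finite metric \<Rightarrow> (real \<Rightarrow> real^'n) \<Rightarrow> (real \<Rightarrow> real^'n) \<Rightarrow> real \<Rightarrow> real^'n" where
  "cov_deriv g c V s = (\<chi> k. vector_derivative V (at s) $ k +
     (\<Sum>i\<in>UNIV. \<Sum>j\<in>UNIV.
        christoffel g k i j (c s) * vector_derivative c (at s) $ i * V s $ j))"

definition geodesic :: "'n::finite metric \<Rightarrow> real set \<Rightarrow> (real \<Rightarrow> real^'n) \<Rightarrow> bool" where
  "geodesic g I c \<longleftrightarrow> smooth_on I c \<and>
     (\<forall>s\<in>I. cov_deriv g c (\<lambda>r. vector_derivative c (at r)) s = 0)"

text \<open>
  Quantifying over geodesics defined on all of \<open>\<real>\<close> is appropriate for complete metrics,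
  such as left-invariant metrics on Lie groups.
\<close>

definition riem_exp :: "'n::finite metric \<Rightarrow> real^'n \<Rightarrow> real^'n \<Rightarrow> real^'n" where
  "riem_exp g q v =
     (THE w. \<exists>c. geodesic g UNIV c \<and> c 0 = q \<and> vector_derivative c (at 0) = v \<and> c 1 = w)"


text \<open>The group Sol(3) and its left-invariant metric\<close>

definition matrix_exp :: "real^'n^'n \<Rightarrow> real^'n^'n::finite" where
  "matrix_exp M = (\<Sum>k. (1 / fact k) *\<^sub>R (((\<lambda>N. M ** N) ^^ k) (mat 1)))"

definition sol_A :: "real \<Rightarrow> real^2^2" where
  "sol_A p = vector [vector [p, -1], vector [1, p]]"

definition sol_mult :: "real \<Rightarrow> real^3 \<Rightarrow> real^3 \<Rightarrow> real^3" where
  "sol_mult p q q' =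
     (let w = matrix_exp (q$1 *\<^sub>R sol_A p) *v vector [q'$2, q'$3] + vector [q$2, q$3]
      in vector [q$1 + q'$1, w$1, w$2])"

text \<open>
  The left-invariant frame \<open>e\<^sub>i\<close>: the standard basis at the identity \<open>0\<close>, transported by the
  differential of left translation.
\<close>

definition sol_e :: "real \<Rightarrow> 3 \<Rightarrow> real^3 \<Rightarrow> real^3" where
  "sol_e p i q = frechet_derivative (sol_mult p q) (at 0) (axis i 1)"

text \<open>The dual coframe: coordinates with respect to the basis with columns \<open>e\<^sub>i\<close>.\<close>

definition sol_coframe :: "real \<Rightarrow> 3 \<Rightarrow> real^3 \<Rightarrow> real^3 \<Rightarrow> real" where
  "sol_coframe p i q v = (matrix_inv (\<chi> k j. sol_e p j q $ k) *v v) $ i"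

definition sol_metric :: "real \<Rightarrow> real \<Rightarrow> real \<Rightarrow> 3 metric" where
  "sol_metric p \<epsilon> \<alpha> q v w =
     \<epsilon>\<^sup>2 * (sol_coframe p 1 q v * sol_coframe p 1 q w) +
     \<alpha>\<^sup>2 * (sol_coframe p 2 q v * sol_coframe p 2 q w + sol_coframe p 3 q v * sol_coframe p 3 q w)"

definition sol_u :: "real \<Rightarrow> real \<Rightarrow> real \<Rightarrow> 3 \<Rightarrow> real^3 \<Rightarrow> real^3" where
  "sol_u p \<epsilon> \<alpha> i q = (if i = 1 then 1 / \<epsilon> else 1 / \<alpha>) *\<^sub>R sol_e p i q"


text \<open>Ruled surfaces parametrised by \<open>T \<times> S\<close>\<close>

definition d_t :: "(real \<times> real \<Rightarrow> real^'n) \<Rightarrow> real \<Rightarrow> real \<Rightarrow> real^'n::finite" where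
  "d_t F t s = vector_derivative (\<lambda>\<tau>. F (\<tau>, s)) (at t)"

definition d_s :: "(real \<times> real \<Rightarrow> real^'n) \<Rightarrow> real \<Rightarrow> real \<Rightarrow> real^'n::finite" where
  "d_s F t s = vector_derivative (\<lambda>r. F (t, r)) (at s)"

definition ruled_surface ::
    "'n::finite metric \<Rightarrow> real set \<Rightarrow> real set \<Rightarrow> (real \<times> real \<Rightarrow> real^'n) \<Rightarrow> bool" where
  "ruled_surface g T S F \<longleftrightarrow> smooth_on (T \<times> S) F \<and>
     (\<exists>\<gamma> X. smooth_on T \<gamma> \<and> smooth_on T X \<and> (\<forall>t\<in>T. X t \<noteq> 0) \<and>
        (\<forall>t\<in>T. \<forall>s\<in>S. F (t, s) = riem_exp g (\<gamma> t) (s *\<^sub>R X t)))"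

definition orthogonal_ruled_surface ::
    "'n::finite metric \<Rightarrow> real set \<Rightarrow> real set \<Rightarrow> (real \<times> real \<Rightarrow> real^'n) \<Rightarrow> bool" where
  "orthogonal_ruled_surface g T S F \<longleftrightarrow> ruled_surface g T S F \<and>
     (\<forall>t\<in>T. \<forall>s\<in>S. g (F (t, s)) (d_t F t s) (d_s F t s) = 0)"

text \<open>
  Affine change of the parameter of the rulings: \<open>F \<circ> (t, s) \<mapsto> (t, k s)\<close> is defined on
  \<open>T \<times> rescale_dom k S\<close>. It serves to make the constant speed of the rulings equal to 1.
\<close>

definition rescale :: "real \<Rightarrow> (real \<times> real \<Rightarrow> real^'n) \<Rightarrow> real \<times> real \<Rightarrow> real^'n::finite" where
  "rescale k F = (\<lambda>(t, s). F (t, k * s))"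

definition rescale_dom :: "real \<Rightarrow> real set \<Rightarrow> real set" where
  "rescale_dom k S = {s. k * s \<in> S}"


text \<open>The two normal forms of \<open>(F\<^sub>t, F\<^sub>s)\<close>\<close>

definition sech :: "real \<Rightarrow> real" where
  "sech x = 1 / cosh x"

definition frame_form1 :: "real \<Rightarrow> real \<Rightarrow> real \<Rightarrow> real set \<Rightarrow> real set \<Rightarrow>
    (real \<times> real \<Rightarrow> real^3) \<Rightarrow> (real \<Rightarrow> real) \<Rightarrow> (real \<Rightarrow> real) \<Rightarrow> bool" where
  "frame_form1 p \<epsilon> \<alpha> T S F a1 a2 \<longleftrightarrow> (\<forall>t\<in>T. \<forall>s\<in>S.
     d_s F t s = sol_u p \<epsilon> \<alpha> 1 (F (t, s)) \<and>
     d_t F t s =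
       (exp (- (p / \<epsilon>) * s) * (a1 t * cos (s / \<epsilon>) + a2 t * sin (s / \<epsilon>))) *\<^sub>R sol_u p \<epsilon> \<alpha> 2 (F (t, s)) +
       (exp (- (p / \<epsilon>) * s) * (a2 t * cos (s / \<epsilon>) - a1 t * sin (s / \<epsilon>))) *\<^sub>R sol_u p \<epsilon> \<alpha> 3 (F (t, s)))"

definition frame_form2 :: "real \<Rightarrow> real \<Rightarrow> real \<Rightarrow> real set \<Rightarrow> real set \<Rightarrow>
    (real \<times> real \<Rightarrow> real^3) \<Rightarrow>
    (real \<Rightarrow> real) \<Rightarrow> (real \<Rightarrow> real) \<Rightarrow> (real \<Rightarrow> real) \<Rightarrow> (real \<Rightarrow> real) \<Rightarrow> bool" where
  "frame_form2 p \<epsilon> \<alpha> T S F c1 \<theta> b1 b2 \<longleftrightarrow> (\<forall>t\<in>T. \<forall>s\<in>S.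
     let \<omega> = p / \<epsilon> * s + c1 t;
         \<sigma> = 1 / p * ln (cosh \<omega>) + \<theta> t;
         F1 = - b2 t - \<epsilon> / p * deriv c1 t * tanh \<omega>;
         F2 = (- b2 t * sinh \<omega> - \<epsilon> / p * deriv c1 t * sinh \<omega> * tanh \<omega>) * cos \<sigma>
            - (- b1 t * cosh \<omega> + (\<epsilon> * deriv \<theta> t - b2 t) / p * sinh \<omega>) * sin \<sigma>;
         F3 = (- b1 t * cosh \<omega> + (\<epsilon> * deriv \<theta> t - b2 t) / p * sinh \<omega>) * cos \<sigma>
            - (b2 t * sinh \<omega> + \<epsilon> / p * deriv c1 t * sinh \<omega> * tanh \<omega>) * sin \<sigma>;
         u = (\<lambda>i. sol_u p \<epsilon> \<alpha> i (F (t, s)))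
     in d_s F t s = - tanh \<omega> *\<^sub>R u 1 + (sech \<omega> * cos \<sigma>) *\<^sub>R u 2 + (sech \<omega> * sin \<sigma>) *\<^sub>R u 3 \<and>
        d_t F t s = F1 *\<^sub>R u 1 + F2 *\<^sub>R u 2 + F3 *\<^sub>R u 3)"

text \<open>
  The parameters of those rulings that are everywhere, respectively nowhere, tangent to \<open>u\<^sub>1\<close>.
  Both kinds may occur on one connected surface (rotate \<open>X(t)\<close> through \<open>u\<^sub>1\<close> with \<open>\<gamma>\<close> constant),
  so a normal form can hold only on intervals of parameters of constant kind.
\<close>

definition tangent_rulings ::
    "real \<Rightarrow> real \<Rightarrow> real \<Rightarrow> real set \<Rightarrow> real set \<Rightarrow> (real \<times> real \<Rightarrow> real^3) \<Rightarrow> real set" where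
  "tangent_rulings p \<epsilon> \<alpha> T S F = {t\<in>T. \<forall>s\<in>S. d_s F t s \<in> span {sol_u p \<epsilon> \<alpha> 1 (F (t, s))}}"

definition transverse_rulings ::
    "real \<Rightarrow> real \<Rightarrow> real \<Rightarrow> real set \<Rightarrow> real set \<Rightarrow> (real \<times> real \<Rightarrow> real^3) \<Rightarrow> real set" where
  "transverse_rulings p \<epsilon> \<alpha> T S F = {t\<in>T. \<forall>s\<in>S. d_s F t s \<notin> span {sol_u p \<epsilon> \<alpha> 1 (F (t, s))}}"

end

theory Submission
  imports Defs
begin

text \<open>
  In the global chart \<open>exp (x A)\<close> is \<open>e\<^bsup>px\<^esup>\<close> times the rotation by \<open>x\<close>, so the metric is
  \<open>\<epsilon>\<^sup>2 dx\<^sup>2 + \<alpha>\<^sup>2 e\<^bsup>-2px\<^esup> (dy\<^sup>2 + dz\<^sup>2)\<close>: Sol(3) with this metric is a hyperbolic space, and only the frame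
  sees the rotation. Along a geodesic \<open>e\<^bsup>-2px\<^esup> (y', z')\<close> and the energy are conserved, so \<open>e\<^bsup>-px\<^esup>\<close> solves
  \<open>w'' = \<kappa>\<^sup>2 w\<close>. The geodesics are therefore the lines tangent to \<open>u\<^sub>1\<close> and the semi-ellipses
  \<open>(X - ln (cosh w) / p, (Y, Z) + \<epsilon> / (p \<alpha>) e\<^bsup>pX\<^esup> tanh w (cos \<phi>, sin \<phi>))\<close> with \<open>w\<close> affine in the
  parameter.

  A surface ruled by the latter is given by six functions of \<open>t\<close>: \<open>X, Y, Z, \<phi>\<close> and the
  coefficients of \<open>w = a s + c\<^sub>1\<close>. The product \<open>g(F\<^sub>t, F\<^sub>s)\<close> is a nonzero multiple of
  \<open>\<epsilon> / p (a' s + c\<^sub>1') + \<alpha> e\<^bsup>-pX\<^esup> (Y' cos \<phi> + Z' sin \<phi>)\<close>, so orthogonality means that \<open>a\<close> is constant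
  and that the component of \<open>(Y', Z')\<close> in the direction \<open>\<phi>\<close> is determined by \<open>c\<^sub>1'\<close>. The remaining
  data are \<open>c\<^sub>1\<close>, \<open>\<theta> = \<phi> - X\<close>, \<open>b\<^sub>2 = - \<epsilon> X'\<close> and \<open>b\<^sub>1\<close>, which is \<open>\<alpha> e\<^bsup>-pX\<^esup>\<close> times the
  component of \<open>(Y', Z')\<close> orthogonal to \<open>\<phi>\<close>; conversely these determine \<open>X, Y, Z\<close> by integration.
\<close>

section \<open>Smooth maps\<close>

lemma Ck_on_SucD:
  assumes "Ck_on (Suc k) S f" "x \<in> S"
  shows "(f has_derivative frechet_derivative f (at x)) (at x)"
  using assms by (simp add: frechet_derivative_works)

text \<open>Openness of \<open>S\<close> makes equality on \<open>S\<close> a local equality at each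
  of its points, so the derivatives agree on \<open>S\<close> too and the induction can pass to
  them.\<close>

lemma Ck_on_cong:
  assumes "open S" "\<And>x. x \<in> S \<Longrightarrow> f x = g x" "Ck_on k S f"
  shows "Ck_on k S g"
  using assms(2,3)
proof (induction k arbitrary: f g)
  case 0
  then show ?case using continuous_on_cong by fastforce
next
  case (Suc k)
  have d: "(g has_derivative frechet_derivative f (at x)) (at x)" if "x \<in> S" for x
    using has_derivative_transform_within_open[OF Ck_on_SucD[OF Suc.prems(2) that] \<open>open S\<close> that]
      Suc.prems(1) by blast
  have e: "frechet_derivative f (at x) = frechet_derivative g (at x)" if "x \<in> S" for x
    using d[OF that] frechet_derivative_at by blast
  have "Ck_on k S (\<lambda>x. frechet_derivative g (at x) v)" for v
    using Suc.IH[of "\<lambda>x. frechet_derivative f (at x) v" "\<lambda>x. frechet_derivative g (at x) v"]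
      e Suc.prems(2) by simp
  then show ?case using d by (auto simp: differentiable_def)
qed

text \<open>\<open>frechet_derivative\<close> is a choice term; uniqueness of the derivative
  replaces it on \<open>S\<close> by any explicit formula. The inductions for the closure properties
  below take their successor step through this rule.\<close>

lemma Ck_on_SucI:
  assumes "open S" "\<And>x. x \<in> S \<Longrightarrow> (f has_derivative f' x) (at x)"
    and "\<And>v. Ck_on k S (\<lambda>x. f' x v)"
  shows "Ck_on (Suc k) S f"
proof -
  have "Ck_on k S (\<lambda>x. frechet_derivative f (at x) v)" for v
    using Ck_on_cong[OF assms(1) _ assms(3)[of v], of "\<lambda>x. frechet_derivative f (at x) v"]
      frechet_derivative_at[OF assms(2)] by metis
  then show ?thesis using assms(2) by (auto simp: differentiable_def)
qed

lemma Ck_on_Suc_imp: "Ck_on (Suc k) S f \<Longrightarrow> Ck_on k S f"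
proof (induction k arbitrary: f)
  case 0
  then show ?case
    by (auto intro!: continuous_at_imp_continuous_on differentiable_imp_continuous_within)
next
  case (Suc k)
  then show ?case by (metis Ck_on.simps(2))
qed

lemma Ck_on_const: "open S \<Longrightarrow> Ck_on k S (\<lambda>x. c)"
proof (induction k arbitrary: c)
  case (Suc k)
  show ?case
    by (rule Ck_on_SucI[where f' = "\<lambda>x v. 0"]) (auto intro: Suc)
qed simp

lemma Ck_on_bounded_linear:
  assumes "open S" "bounded_linear L"
  shows "Ck_on k S f \<Longrightarrow> Ck_on k S (\<lambda>x. L (f x))"
proof (induction k arbitrary: f)
  case 0
  then show ?case using bounded_linear.continuous_on[OF assms(2)] by simp
next
  case (Suc k)
  show ?case
  proof (rule Ck_on_SucI[OF assms(1)])
    fix x assume "x \<in> S"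
    then show "((\<lambda>x. L (f x)) has_derivative (\<lambda>v. L (frechet_derivative f (at x) v))) (at x)"
      by (intro bounded_linear.has_derivative[OF assms(2)] Ck_on_SucD[OF Suc.prems])
  next
    show "Ck_on k S (\<lambda>x. L (frechet_derivative f (at x) v))" for v
      using Suc by simp
  qed
qed

lemma Ck_on_linear:
  assumes "open S" "bounded_linear L"
  shows "Ck_on k S L"
proof (cases k)
  case 0
  then show ?thesis using linear_continuous_on[OF assms(2)] by simp
next
  case (Suc n)
  show ?thesis unfolding Suc
    by (rule Ck_on_SucI[where f' = "\<lambda>x. L"])
       (auto intro: assms Ck_on_const bounded_linear_imp_has_derivative)
qed

lemma Ck_on_add:
  assumes "open S"
  shows "Ck_on k S f \<Longrightarrow> Ck_on k S g \<Longrightarrow> Ck_on k S (\<lambda>x. f x + g x)"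
proof (induction k arbitrary: f g)
  case 0
  then show ?case by (auto intro: continuous_intros)
next
  case (Suc k)
  show ?case
  proof (rule Ck_on_SucI[OF assms(1)])
    fix x assume "x \<in> S"
    then show "((\<lambda>x. f x + g x) has_derivative
        (\<lambda>v. frechet_derivative f (at x) v + frechet_derivative g (at x) v)) (at x)"
      by (intro has_derivative_add Ck_on_SucD[OF Suc.prems(1)] Ck_on_SucD[OF Suc.prems(2)])
  next
    show "Ck_on k S (\<lambda>x. frechet_derivative f (at x) v + frechet_derivative g (at x) v)" for v
      using Suc by simp
  qed
qed

text \<open>The product rule brings back the undifferentiated \<open>f\<close> and \<open>g\<close>,
  which the induction hypothesis needs at the lower order; hence
  \<open>Ck_on_Suc_imp\<close>.\<close>

lemma Ck_on_bounded_bilinear: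
  assumes "open S" "bounded_bilinear B"
  shows "Ck_on k S f \<Longrightarrow> Ck_on k S g \<Longrightarrow> Ck_on k S (\<lambda>x. B (f x) (g x))"
proof (induction k arbitrary: f g)
  case 0
  then show ?case using bounded_bilinear.continuous_on[OF assms(2)] by simp
next
  case (Suc k)
  show ?case
  proof (rule Ck_on_SucI[OF assms(1)])
    fix x assume "x \<in> S"
    then show "((\<lambda>x. B (f x) (g x)) has_derivative
        (\<lambda>v. B (f x) (frechet_derivative g (at x) v) + B (frechet_derivative f (at x) v) (g x))) (at x)"
      by (intro bounded_bilinear.FDERIV[OF assms(2)] Ck_on_SucD[OF Suc.prems(1)]
          Ck_on_SucD[OF Suc.prems(2)])
  next
    show "Ck_on k S (\<lambda>x. B (f x) (frechet_derivative g (at x) v) +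
        B (frechet_derivative f (at x) v) (g x))" for v
      using Suc.prems Suc.prems[THEN Ck_on_Suc_imp] by (intro Ck_on_add assms Suc.IH) auto
  qed
qed

text \<open>With a real intermediate variable the derivative of \<open>h\<close> is fixed by its
  value at 1, so the chain rule yields a product of two functions and the bilinear rule finishes the
  step.\<close>

lemma Ck_on_compose_real:
  fixes h :: "real \<Rightarrow> 'b::real_normed_vector"
  assumes "open S" "open U" "\<And>x. x \<in> S \<Longrightarrow> f x \<in> U"
  shows "Ck_on k U h \<Longrightarrow> Ck_on k S f \<Longrightarrow> Ck_on k S (\<lambda>x. h (f x))"
proof (induction k arbitrary: h)
  case 0
  then show ?case using assms(3) by (auto intro: continuous_on_compose2)
next
  case (Suc k)
  show ?case
  proof (rule Ck_on_SucI[OF assms(1)])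
    fix x assume x: "x \<in> S"
    have d: "(h has_derivative frechet_derivative h (at (f x))) (at (f x))"
      using Ck_on_SucD[OF Suc.prems(1) assms(3)[OF x]] .
    interpret bounded_linear "frechet_derivative h (at (f x))"
      using d by (rule has_derivative_bounded_linear)
    have "frechet_derivative h (at (f x)) = (\<lambda>r. r *\<^sub>R frechet_derivative h (at (f x)) 1)"
    proof
      show "frechet_derivative h (at (f x)) r = r *\<^sub>R frechet_derivative h (at (f x)) 1" for r
        using scale[of r 1] by simp
    qed
    then have "(h has_derivative (\<lambda>r. r *\<^sub>R frechet_derivative h (at (f x)) 1)) (at (f x))"
      using d by simp
    from has_derivative_compose[OF Ck_on_SucD[OF Suc.prems(2) x] this]
    show "((\<lambda>x. h (f x)) has_derivative
        (\<lambda>v. frechet_derivative f (at x) v *\<^sub>R frechet_derivative h (at (f x)) 1)) (at x)" .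
  next
    show "Ck_on k S (\<lambda>x. frechet_derivative f (at x) v *\<^sub>R frechet_derivative h (at (f x)) 1)" for v
    proof (rule Ck_on_bounded_bilinear[OF assms(1) bounded_bilinear_scaleR])
      show "Ck_on k S (\<lambda>x. frechet_derivative f (at x) v)" using Suc.prems(2) by simp
      show "Ck_on k S (\<lambda>x. frechet_derivative h (at (f x)) 1)"
        using Suc.IH[of "\<lambda>y. frechet_derivative h (at y) 1"] Suc.prems(1)
          Ck_on_Suc_imp[OF Suc.prems(2)] by simp
    qed
  qed
qed

section \<open>Smooth maps and elementary functions\<close>

lemma smooth_on_imp_Ck: "smooth_on S f \<Longrightarrow> Ck_on k S f"
  by (simp add: smooth_on_def)

lemma smooth_on_subset:
  assumes "smooth_on S f" "U \<subseteq> S"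
  shows "smooth_on U f"
proof -
  have "Ck_on k S f \<Longrightarrow> Ck_on k U f" for k
    using assms(2)
  proof (induction k arbitrary: f)
    case 0
    then show ?case using continuous_on_subset by auto
  next
    case (Suc k)
    then show ?case by (auto simp: subset_eq)
  qed
  then show ?thesis using assms(1) by (auto simp: smooth_on_def)
qed

lemma smooth_on_cong:
  "open S \<Longrightarrow> (\<And>x. x \<in> S \<Longrightarrow> f x = g x) \<Longrightarrow> smooth_on S f \<Longrightarrow> smooth_on S g"
  unfolding smooth_on_def using Ck_on_cong by metis

lemma smooth_on_const: "open S \<Longrightarrow> smooth_on S (\<lambda>x. c)"
  by (simp add: smooth_on_def Ck_on_const)

lemma smooth_on_linear: "open S \<Longrightarrow> bounded_linear L \<Longrightarrow> smooth_on S L"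
  by (simp add: smooth_on_def Ck_on_linear)

lemma smooth_on_ident: "open S \<Longrightarrow> smooth_on S (\<lambda>x. x)"
  by (simp add: smooth_on_linear bounded_linear_ident)

lemma smooth_on_fst: "open S \<Longrightarrow> smooth_on S (\<lambda>x. fst x)"
  by (simp add: smooth_on_linear bounded_linear_fst)

lemma smooth_on_snd: "open S \<Longrightarrow> smooth_on S (\<lambda>x. snd x)"
  by (simp add: smooth_on_linear bounded_linear_snd)

lemma smooth_on_bounded_linear:
  "open S \<Longrightarrow> bounded_linear L \<Longrightarrow> smooth_on S f \<Longrightarrow> smooth_on S (\<lambda>x. L (f x))"
  by (simp add: smooth_on_def Ck_on_bounded_linear)

lemma smooth_on_add:
  "open S \<Longrightarrow> smooth_on S f \<Longrightarrow> smooth_on S g \<Longrightarrow> smooth_on S (\<lambda>x. f x + g x)"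
  by (simp add: smooth_on_def Ck_on_add)

lemma smooth_on_minus: "open S \<Longrightarrow> smooth_on S f \<Longrightarrow> smooth_on S (\<lambda>x. - f x)"
  by (rule smooth_on_bounded_linear[OF _ bounded_linear_minus[OF bounded_linear_ident]])

lemma smooth_on_diff:
  "open S \<Longrightarrow> smooth_on S f \<Longrightarrow> smooth_on S g \<Longrightarrow> smooth_on S (\<lambda>x. f x - g x)"
  using smooth_on_add[OF _ _ smooth_on_minus, of S f g] by simp

lemma smooth_on_mult:
  fixes f g :: "_ \<Rightarrow> real"
  shows "open S \<Longrightarrow> smooth_on S f \<Longrightarrow> smooth_on S g \<Longrightarrow> smooth_on S (\<lambda>x. f x * g x)"
  by (simp add: smooth_on_def Ck_on_bounded_bilinear[OF _ bounded_bilinear_mult])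

lemma smooth_on_power:
  fixes f :: "_ \<Rightarrow> real"
  shows "open S \<Longrightarrow> smooth_on S f \<Longrightarrow> smooth_on S (\<lambda>x. f x ^ n)"
  by (induction n) (auto intro: smooth_on_const smooth_on_mult)

lemma smooth_on_compose:
  fixes h :: "real \<Rightarrow> 'b::real_normed_vector"
  shows "open S \<Longrightarrow> open U \<Longrightarrow> (\<And>x. x \<in> S \<Longrightarrow> f x \<in> U) \<Longrightarrow> smooth_on U h \<Longrightarrow> smooth_on S f
    \<Longrightarrow> smooth_on S (\<lambda>x. h (f x))"
  unfolding smooth_on_def using Ck_on_compose_real by metis

lemma Ck_on_Suc_realI:
  fixes f :: "real \<Rightarrow> real"
  assumes "open S" "\<And>x. x \<in> S \<Longrightarrow> (f has_real_derivative f' x) (at x)" "Ck_on k S f'"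
  shows "Ck_on (Suc k) S f"
proof (rule Ck_on_SucI[OF assms(1)])
  show "x \<in> S \<Longrightarrow> (f has_derivative (*) (f' x)) (at x)" for x
    using assms(2) by (simp add: has_field_derivative_def)
  show "Ck_on k S (\<lambda>x. f' x * v)" for v
    using Ck_on_bounded_bilinear[OF assms(1) bounded_bilinear_mult assms(3) Ck_on_const[OF assms(1)]] .
qed

text \<open>A derivative of class k puts \<open>f\<close> into class k + 1; dropping the surplus
  order treats all k, including 0, at once.\<close>

lemma smooth_on_antiderivative:
  fixes f :: "real \<Rightarrow> real"
  assumes "open S" "\<And>x. x \<in> S \<Longrightarrow> (f has_real_derivative f' x) (at x)" "smooth_on S f'"
  shows "smooth_on S f"
  unfolding smooth_on_def
proof
  fix k
  show "Ck_on k S f"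
    by (rule Ck_on_Suc_imp[OF Ck_on_Suc_realI[OF assms(1,2) smooth_on_imp_Ck[OF assms(3)]]])
qed

lemma smooth_on_exp:
  fixes f :: "_ \<Rightarrow> real"
  assumes "open S" "smooth_on S f"
  shows "smooth_on S (\<lambda>x. exp (f x))"
proof -
  have "Ck_on k UNIV (exp :: real \<Rightarrow> real)" for k
  proof (induction k)
    case 0
    show ?case by (auto intro: continuous_intros)
  next
    case (Suc k)
    then show ?case by (intro Ck_on_Suc_realI) (auto intro: DERIV_exp)
  qed
  then show ?thesis
    using smooth_on_compose[OF assms(1) open_UNIV _ _ assms(2), of exp] by (simp add: smooth_on_def)
qed

lemma smooth_on_sin_cos:
  fixes f :: "_ \<Rightarrow> real"
  assumes "open S" "smooth_on S f"
  shows smooth_on_sin: "smooth_on S (\<lambda>x. sin (f x))"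
    and smooth_on_cos: "smooth_on S (\<lambda>x. cos (f x))"
proof -
  \<comment> \<open>Sine and cosine are each other's derivative up to sign, so the induction closes
    only for both together.\<close>
  have *: "Ck_on k UNIV (sin :: real \<Rightarrow> real) \<and> Ck_on k UNIV (cos :: real \<Rightarrow> real)" for k
  proof (induction k)
    case 0
    show ?case by (auto intro: continuous_intros)
  next
    case (Suc k)
    have m: "Ck_on k UNIV (\<lambda>x::real. - sin x)"
      using Suc Ck_on_bounded_linear[OF open_UNIV bounded_linear_minus[OF bounded_linear_ident]]
      by blast
    show ?case
      using Ck_on_Suc_realI[OF open_UNIV DERIV_sin] Ck_on_Suc_realI[OF open_UNIV DERIV_cos m] Suc
      by blast
  qed
  then show "smooth_on S (\<lambda>x. sin (f x))" "smooth_on S (\<lambda>x. cos (f x))"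
    using smooth_on_compose[OF assms(1) open_UNIV _ _ assms(2), of sin]
      smooth_on_compose[OF assms(1) open_UNIV _ _ assms(2), of cos] by (simp_all add: smooth_on_def)
qed

lemma smooth_on_inverse:
  fixes f :: "_ \<Rightarrow> real"
  assumes "open S" "smooth_on S f" "\<And>x. x \<in> S \<Longrightarrow> f x \<noteq> 0"
  shows "smooth_on S (\<lambda>x. inverse (f x))"
proof -
  have o: "open (- {0::real})" by auto
  have "Ck_on k (- {0}) (inverse :: real \<Rightarrow> real)" for k
  proof (induction k)
    case 0
    show ?case by (auto intro: continuous_intros)
  next
    case (Suc k)
    have "Ck_on k (- {0}) (\<lambda>x::real. - (inverse x * inverse x))"
      by (intro Ck_on_bounded_linear[OF o bounded_linear_minus[OF bounded_linear_ident]]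
          Ck_on_bounded_bilinear[OF o bounded_bilinear_mult] Suc)
    then show ?case
      by (intro Ck_on_Suc_realI[where f' = "\<lambda>x. - (inverse x * inverse x)"])
         (auto intro!: derivative_eq_intros o)
  qed
  then show ?thesis
    using smooth_on_compose[OF assms(1) o _ _ assms(2), of inverse] assms(3)
    by (simp add: smooth_on_def)
qed

lemma smooth_on_divide:
  fixes f g :: "_ \<Rightarrow> real"
  assumes "open S" "smooth_on S f" "smooth_on S g" "\<And>x. x \<in> S \<Longrightarrow> g x \<noteq> 0"
  shows "smooth_on S (\<lambda>x. f x / g x)"
  unfolding divide_inverse using assms by (intro smooth_on_mult smooth_on_inverse)

lemma smooth_on_ln:
  fixes f :: "_ \<Rightarrow> real"
  assumes "open S" "smooth_on S f" "\<And>x. x \<in> S \<Longrightarrow> f x > 0"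
  shows "smooth_on S (\<lambda>x. ln (f x))"
proof -
  have "smooth_on {0<..} (ln :: real \<Rightarrow> real)"
    by (rule smooth_on_antiderivative[where f' = inverse])
       (auto intro!: smooth_on_inverse smooth_on_ident DERIV_ln)
  then show ?thesis
    using smooth_on_compose[OF assms(1) open_greaterThan _ _ assms(2)] assms(3) by auto
qed

lemma smooth_on_sqrt:
  fixes f :: "_ \<Rightarrow> real"
  assumes "open S" "smooth_on S f" "\<And>x. x \<in> S \<Longrightarrow> f x > 0"
  shows "smooth_on S (\<lambda>x. sqrt (f x))"
proof (rule smooth_on_cong[OF assms(1)])
  show "smooth_on S (\<lambda>x. exp (ln (f x) / 2))"
    using assms by (intro smooth_on_exp smooth_on_divide smooth_on_ln smooth_on_const) auto
  show "exp (ln (f x) / 2) = sqrt (f x)" if "x \<in> S" for x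
    using assms(3)[OF that] by (simp add: ln_sqrt[symmetric])
qed

lemma smooth_on_cosh:
  fixes f :: "_ \<Rightarrow> real"
  shows "open S \<Longrightarrow> smooth_on S f \<Longrightarrow> smooth_on S (\<lambda>x. cosh (f x))"
  unfolding cosh_field_def by (auto intro!: smooth_on_divide smooth_on_add smooth_on_exp smooth_on_minus smooth_on_const)

lemma smooth_on_sinh:
  fixes f :: "_ \<Rightarrow> real"
  shows "open S \<Longrightarrow> smooth_on S f \<Longrightarrow> smooth_on S (\<lambda>x. sinh (f x))"
  unfolding sinh_field_def by (auto intro!: smooth_on_divide smooth_on_diff smooth_on_exp smooth_on_minus smooth_on_const)

lemma smooth_on_tanh:
  fixes f :: "_ \<Rightarrow> real"
  shows "open S \<Longrightarrow> smooth_on S f \<Longrightarrow> smooth_on S (\<lambda>x. tanh (f x))"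
  unfolding tanh_def by (auto intro!: smooth_on_divide smooth_on_sinh smooth_on_cosh)

lemma smooth_on_arsinh:
  fixes f :: "_ \<Rightarrow> real"
  assumes "open S" "smooth_on S f"
  shows "smooth_on S (\<lambda>x. arsinh (f x))"
proof -
  have "smooth_on S (\<lambda>x. ln (f x + sqrt ((f x)\<^sup>2 + 1)))"
    using assms arsinh_real_aux
    by (intro smooth_on_ln smooth_on_add smooth_on_sqrt smooth_on_power smooth_on_const)
       (auto simp: add_nonneg_pos)
  then show ?thesis by (simp add: arsinh_real_def)
qed

lemmas smooth_intros = smooth_on_const smooth_on_ident smooth_on_fst smooth_on_snd smooth_on_add
  smooth_on_minus smooth_on_diff smooth_on_mult smooth_on_power smooth_on_exp smooth_on_sin
  smooth_on_cos smooth_on_divide smooth_on_ln smooth_on_cosh smooth_on_sinh smooth_on_tanh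
  smooth_on_arsinh smooth_on_sqrt

lemma smooth_on_nth:
  "open S \<Longrightarrow> smooth_on S f \<Longrightarrow> smooth_on S (\<lambda>x. f x $ i)"
  by (rule smooth_on_bounded_linear[OF _ bounded_linear_vec_nth])

lemma smooth_on_vector_3:
  fixes f g h :: "_ \<Rightarrow> real"
  assumes "open S" "smooth_on S f" "smooth_on S g" "smooth_on S h"
  shows "smooth_on S (\<lambda>x. vector [f x, g x, h x] :: real^3)"
proof -
  have "smooth_on S (\<lambda>x. f x *\<^sub>R axis 1 1 + g x *\<^sub>R axis 2 1 + h x *\<^sub>R axis 3 1 :: real^3)"
    using assms by (intro smooth_on_add smooth_on_bounded_linear[OF _ bounded_linear_scaleR_left])
  moreover have "f x *\<^sub>R axis 1 1 + g x *\<^sub>R axis 2 1 + h x *\<^sub>R axis 3 1 = (vector [f x, g x, h x] :: real^3)" for x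
    by (simp add: vec_eq_iff forall_3 axis_def)
  ultimately show ?thesis by simp
qed

lemma smooth_on_has_vector_derivative:
  fixes f :: "real \<Rightarrow> 'b::real_normed_vector"
  assumes "smooth_on S f" "x \<in> S"
  shows "(f has_vector_derivative vector_derivative f (at x)) (at x)"
proof -
  have "f differentiable (at x)"
    using smooth_on_imp_Ck[OF assms(1), of 1] assms(2) by simp
  then show ?thesis using vector_derivative_works by blast
qed

text \<open>Bridge between two notions of derivative: \<open>Ck_on\<close> differentiates by
  \<open>frechet_derivative\<close>, while velocities of curves are
  \<open>vector_derivative\<close>, which is the former evaluated at 1.\<close>

lemma smooth_on_vector_derivative:
  fixes f :: "real \<Rightarrow> 'b::real_normed_vector"
  assumes "open S" "smooth_on S f"
  shows "smooth_on S (\<lambda>x. vector_derivative f (at x))"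
proof (rule smooth_on_cong[OF assms(1)])
  show "smooth_on S (\<lambda>x. frechet_derivative f (at x) 1)"
    unfolding smooth_on_def
  proof
    show "Ck_on k S (\<lambda>x. frechet_derivative f (at x) 1)" for k
      using smooth_on_imp_Ck[OF assms(2), of "Suc k"] by simp
  qed
  fix x assume "x \<in> S"
  then have "(f has_derivative (\<lambda>r. r *\<^sub>R vector_derivative f (at x))) (at x)"
    using smooth_on_has_vector_derivative[OF assms(2)] by (simp add: has_vector_derivative_def)
  from frechet_derivative_at[OF this, symmetric]
  show "frechet_derivative f (at x) 1 = vector_derivative f (at x)"
    by simp
qed

lemma smooth_on_has_real_derivative:
  fixes f :: "real \<Rightarrow> real"
  assumes "smooth_on S f" "x \<in> S"
  shows "(f has_real_derivative deriv f x) (at x)"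
proof -
  have "(f has_real_derivative vector_derivative f (at x)) (at x)"
    using smooth_on_has_vector_derivative[OF assms]
    by (simp add: has_real_derivative_iff_has_vector_derivative)
  then show ?thesis by (simp add: DERIV_imp_deriv)
qed

lemma smooth_on_deriv:
  fixes f :: "real \<Rightarrow> real"
  assumes "open S" "smooth_on S f"
  shows "smooth_on S (deriv f)"
proof (rule smooth_on_cong[OF assms(1) _ smooth_on_vector_derivative[OF assms]])
  fix x assume "x \<in> S"
  then have "(f has_vector_derivative deriv f x) (at x)"
    using smooth_on_has_real_derivative[OF assms(2)]
    by (simp add: has_real_derivative_iff_has_vector_derivative)
  then show "vector_derivative f (at x) = deriv f x"
    by (rule vector_derivative_at)
qed

lemma smooth_on_imp_continuous_on: "smooth_on S f \<Longrightarrow> continuous_on S f"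
  using smooth_on_imp_Ck[of S f 0] by simp

section \<open>Antiderivatives and angle functions on open intervals\<close>

lemma open_interval_between:
  assumes "open_interval J" "x \<in> J" "y \<in> J"
  obtains a b where "a < x" "a < y" "x < b" "y < b" "{a..b} \<subseteq> J"
proof -
  have o: "open J" and i: "\<And>a b z. a \<in> J \<Longrightarrow> b \<in> J \<Longrightarrow> a \<le> z \<Longrightarrow> z \<le> b \<Longrightarrow> z \<in> J"
    using assms(1) unfolding open_interval_def is_interval_1 by blast+
  have "min x y \<in> J" "max x y \<in> J" using assms by (auto simp: min_def max_def)
  with o obtain e e' where e: "e > 0" "cball (min x y) e \<subseteq> J" "e' > 0" "cball (max x y) e' \<subseteq> J"
    by (meson open_contains_cball)
  then have "min x y - e \<in> J" "max x y + e' \<in> J"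
    by (auto simp: subset_eq dist_real_def)
  then have "{min x y - e..max x y + e'} \<subseteq> J"
    using i by (meson atLeastAtMost_iff subsetI)
  moreover have "min x y - e < x" "min x y - e < y" "x < max x y + e'" "y < max x y + e'"
    using e(1,3) by linarith+
  ultimately show thesis using that by blast
qed

lemma open_interval_imp_open: "open_interval J \<Longrightarrow> open J"
  by (simp add: open_interval_def)

lemma ex_smooth_antiderivative:
  fixes f :: "real \<Rightarrow> real"
  assumes "open_interval J" "smooth_on J f"
  shows "\<exists>G. smooth_on J G \<and> (\<forall>t\<in>J. (G has_real_derivative f t) (at t))"
proof -
  obtain c where c: "c \<in> J" using assms(1) by (auto simp: open_interval_def)
  \<comment> \<open>The integral is oriented, so \<open>G\<close> also serves points to the left of
    \<open>c\<close>.\<close>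
  define G where "G = (\<lambda>u. LBINT y=c..u. f y)"
  have d: "(G has_real_derivative f t) (at t)" if t: "t \<in> J" for t
  proof -
    \<comment> \<open>A compact interval with \<open>c\<close> and \<open>t\<close> in its interior:
      the fundamental theorem gives a derivative within \<open>{a..b}\<close>, which the margins
      turn into a derivative at \<open>t\<close>.\<close>
    obtain a b where ab: "a < c" "a < t" "c < b" "t < b" "{a..b} \<subseteq> J"
      using open_interval_between[OF assms(1) c t] .
    have "continuous_on {a..b} f"
      using smooth_on_imp_continuous_on[OF assms(2)] ab(5) continuous_on_subset by blast
    then have "(G has_vector_derivative f t) (at t within {a..b})"
      unfolding G_def using ab by (intro interval_integral_FTC2) auto
    then show ?thesis
      using ab at_within_Icc_at[of a t b]
      by (simp add: has_real_derivative_iff_has_vector_derivative)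
  qed
  then show ?thesis
    using smooth_on_antiderivative[OF open_interval_imp_open[OF assms(1)] d assms(2)] by blast
qed

lemma open_interval_constant:
  fixes f :: "real \<Rightarrow> real"
  assumes "open_interval J" "\<And>t. t \<in> J \<Longrightarrow> (f has_real_derivative 0) (at t)" "x \<in> J" "y \<in> J"
  shows "f x = f y"
proof -
  have "convex J" using assms(1) by (simp add: open_interval_def is_interval_convex_1)
  then show ?thesis
    using has_field_derivative_zero_constant[of J f] assms(2-4)
    by (metis has_field_derivative_at_within)
qed

text \<open>If an angle exists, its derivative must be u v' - v u'. Integrating this from the right
  initial angle defines a candidate; seen in the frame rotated by the candidate, the vector (u, v)
  is constant, hence equal to (1, 0).\<close>

lemma smooth_angle_unit:
  fixes u v :: "real \<Rightarrow> real"
  assumes "open_interval J" "smooth_on J u" "smooth_on J v" "\<And>t. t \<in> J \<Longrightarrow> (u t)\<^sup>2 + (v t)\<^sup>2 = 1"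
  shows "\<exists>\<phi>. smooth_on J \<phi> \<and> (\<forall>t\<in>J. u t = cos (\<phi> t) \<and> v t = sin (\<phi> t))"
proof -
  have o: "open J" using assms(1) by (rule open_interval_imp_open)
  obtain c where c: "c \<in> J" using assms(1) by (auto simp: open_interval_def)
  obtain x where x: "u c = cos x" "v c = sin x"
    using sincos_total_2pi[OF assms(4)[OF c]] by metis
  have sd: "smooth_on J (\<lambda>t. u t * deriv v t - v t * deriv u t)"
    using o assms(2,3) by (intro smooth_intros smooth_on_deriv)
  obtain G where G: "smooth_on J G"
      "\<And>t. t \<in> J \<Longrightarrow> (G has_real_derivative u t * deriv v t - v t * deriv u t) (at t)"
    using ex_smooth_antiderivative[OF assms(1) sd] by blast
  define \<phi> where "\<phi> = (\<lambda>t. G t + (x - G c))"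
  have \<phi>: "smooth_on J \<phi>" unfolding \<phi>_def using o G(1) by (intro smooth_intros)
  have d\<phi>: "(\<phi> has_real_derivative u t * deriv v t - v t * deriv u t) (at t)" if "t \<in> J" for t
    unfolding \<phi>_def by (auto intro!: derivative_eq_intros G(2)[OF that])
  \<comment> \<open>Differentiating u^2 + v^2 = 1 shows that (u', v') is orthogonal to (u, v), hence
    a multiple of (- v, u); the factor is the integrand.\<close>
  have uv: "deriv u t = - (u t * deriv v t - v t * deriv u t) * v t"
      "deriv v t = (u t * deriv v t - v t * deriv u t) * u t" if t: "t \<in> J" for t
  proof -
    have "((\<lambda>t. (u t)\<^sup>2 + (v t)\<^sup>2) has_real_derivative 2 * u t * deriv u t + 2 * v t * deriv v t) (at t)"
      using smooth_on_has_real_derivative[OF assms(2) t] smooth_on_has_real_derivative[OF assms(3) t]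
      by (auto intro!: derivative_eq_intros)
    moreover have "((\<lambda>t. (u t)\<^sup>2 + (v t)\<^sup>2) has_real_derivative 0) (at t)"
      by (rule has_field_derivative_transform_within_open[OF DERIV_const[of 1] o t])
         (simp add: assms(4))
    ultimately have "2 * u t * deriv u t + 2 * v t * deriv v t = 0"
      by (rule DERIV_unique)
    then show "deriv u t = - (u t * deriv v t - v t * deriv u t) * v t"
        "deriv v t = (u t * deriv v t - v t * deriv u t) * u t"
      using assms(4)[OF t] by algebra+
  qed
  \<comment> \<open>The two coordinates of (u, v) in the rotated frame.\<close>
  have A: "((\<lambda>t. u t * cos (\<phi> t) + v t * sin (\<phi> t)) has_real_derivative 0) (at t)"
    and B: "((\<lambda>t. v t * cos (\<phi> t) - u t * sin (\<phi> t)) has_real_derivative 0) (at t)" if t: "t \<in> J" for t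
  proof -
    define d where "d = u t * deriv v t - v t * deriv u t"
    have "(u has_real_derivative - d * v t) (at t)" "(v has_real_derivative d * u t) (at t)"
        "(\<phi> has_real_derivative d) (at t)"
      using smooth_on_has_real_derivative[OF assms(2) t] smooth_on_has_real_derivative[OF assms(3) t]
        uv[OF t] d\<phi>[OF t] by (simp_all add: d_def)
    then show "((\<lambda>t. u t * cos (\<phi> t) + v t * sin (\<phi> t)) has_real_derivative 0) (at t)"
      "((\<lambda>t. v t * cos (\<phi> t) - u t * sin (\<phi> t)) has_real_derivative 0) (at t)"
      by (auto intro!: derivative_eq_intros simp: algebra_simps)
  qed
  have "u t = cos (\<phi> t) \<and> v t = sin (\<phi> t)" if t: "t \<in> J" for t
  proof -
    have "\<phi> c = x" by (simp add: \<phi>_def)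
    then have "u t * cos (\<phi> t) + v t * sin (\<phi> t) = 1" "v t * cos (\<phi> t) - u t * sin (\<phi> t) = 0"
      using open_interval_constant[OF assms(1) A t c] open_interval_constant[OF assms(1) B t c] x
      by (auto simp: power2_eq_square[symmetric])
    then show ?thesis
      using sin_cos_squared_add[of "\<phi> t"] by algebra
  qed
  with \<phi> show ?thesis by blast
qed

lemma smooth_angle:
  fixes u v :: "real \<Rightarrow> real"
  assumes "open_interval J" "smooth_on J u" "smooth_on J v" "\<And>t. t \<in> J \<Longrightarrow> (u t)\<^sup>2 + (v t)\<^sup>2 > 0"
  shows "\<exists>\<phi>. smooth_on J \<phi> \<and> (\<forall>t\<in>J. u t = sqrt ((u t)\<^sup>2 + (v t)\<^sup>2) * cos (\<phi> t) \<and>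
    v t = sqrt ((u t)\<^sup>2 + (v t)\<^sup>2) * sin (\<phi> t))"
proof -
  define r where "r = (\<lambda>t. sqrt ((u t)\<^sup>2 + (v t)\<^sup>2))"
  have o: "open J" using assms(1) by (rule open_interval_imp_open)
  have r: "r t > 0" "(r t)\<^sup>2 = (u t)\<^sup>2 + (v t)\<^sup>2" if "t \<in> J" for t
    using assms(4)[OF that] by (auto simp: r_def)
  have "smooth_on J r" unfolding r_def using o assms by (intro smooth_intros)
  then have s: "smooth_on J (\<lambda>t. u t / r t)" "smooth_on J (\<lambda>t. v t / r t)"
    using o assms(2,3) r(1) by (auto intro!: smooth_on_divide simp: less_imp_neq[symmetric])
  have n: "(u t / r t)\<^sup>2 + (v t / r t)\<^sup>2 = 1" if "t \<in> J" for t
    using r[OF that] zero_less_power[OF r(1)[OF that], of 2]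
    by (auto simp: power_divide simp flip: add_divide_distrib)
  obtain \<phi> where "smooth_on J \<phi>"
      "\<And>t. t \<in> J \<Longrightarrow> u t / r t = cos (\<phi> t) \<and> v t / r t = sin (\<phi> t)"
    using smooth_angle_unit[OF assms(1) s n] by blast
  moreover have "u t = r t * (u t / r t) \<and> v t = r t * (v t / r t)" if "t \<in> J" for t
    using r(1)[OF that] by simp
  ultimately have "\<forall>t\<in>J. u t = r t * cos (\<phi> t) \<and> v t = r t * sin (\<phi> t)"
    by metis
  then show ?thesis
    using \<open>smooth_on J \<phi>\<close> unfolding r_def by blast
qed

section \<open>The metric of Sol(3) in the global chart\<close>

lemma matrix_inv_eqI:
  fixes A B :: "real^'n^'n"
  assumes "A ** B = mat 1"
  shows "matrix_inv A = B"
proof -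
  have "B ** A = mat 1" using assms matrix_left_right_inverse by blast
  then have "A ** matrix_inv A = mat 1 \<and> matrix_inv A ** A = mat 1"
    unfolding matrix_inv_def using assms by (intro someI_ex[of "\<lambda>A'. A ** A' = mat 1 \<and> A' ** A = mat 1"]) blast
  then show ?thesis
    using assms by (metis matrix_mul_assoc matrix_mul_lid matrix_mul_rid)
qed

text \<open>The matrix of multiplication by a complex number; it turns \<open>exp (x A)\<close> into the complex
  exponential, as \<open>sol_A p\<close> is multiplication by \<open>p + \<i>\<close>.\<close>

definition complex_matrix :: "complex \<Rightarrow> real^2^2" where
  "complex_matrix z = vector [vector [Re z, - Im z], vector [Im z, Re z]]"

lemma complex_matrix_mult: "complex_matrix z ** complex_matrix w = complex_matrix (z * w)"
  by (simp add: complex_matrix_def matrix_matrix_mult_def vec_eq_iff forall_2 sum_2)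

lemma complex_matrix_power: "((\<lambda>N. complex_matrix z ** N) ^^ k) (mat 1) = complex_matrix (z ^ k)"
proof (induction k)
  case 0
  show ?case by (simp add: complex_matrix_def mat_def vec_eq_iff forall_2)
next
  case (Suc k)
  then show ?case by (simp add: complex_matrix_mult)
qed

lemma bounded_linear_complex_matrix: "bounded_linear complex_matrix"
  unfolding linear_conv_bounded_linear[symmetric]
  by (rule linearI) (simp_all add: complex_matrix_def vec_eq_iff forall_2)

text \<open>The map is bounded linear and multiplicative, so it carries the exponential series of z
  term by term to the matrix series.\<close>

lemma matrix_exp_complex_matrix: "matrix_exp (complex_matrix z) = complex_matrix (exp z)"
proof -
  have "(\<lambda>k. complex_matrix (z ^ k /\<^sub>R fact k)) sums complex_matrix (exp z)"
    using bounded_linear.sums[OF bounded_linear_complex_matrix exp_converges] .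
  moreover have "complex_matrix (z ^ k /\<^sub>R fact k) =
      (1 / fact k) *\<^sub>R ((\<lambda>N. complex_matrix z ** N) ^^ k) (mat 1)" for k
    unfolding complex_matrix_power
    using linear_scale[OF bounded_linear.linear[OF bounded_linear_complex_matrix]]
    by (simp add: inverse_eq_divide)
  ultimately show ?thesis
    by (simp add: matrix_exp_def sums_iff)
qed

lemma matrix_exp_sol_A:
  "matrix_exp (x *\<^sub>R sol_A p) = complex_matrix (of_real (exp (p * x)) * cis x)"
proof -
  have "x *\<^sub>R sol_A p = complex_matrix (Complex (p * x) x)"
    by (simp add: sol_A_def complex_matrix_def vec_eq_iff forall_2)
  then show ?thesis
    by (simp add: matrix_exp_complex_matrix exp_eq_polar)
qed

lemma sol_mult_eq:
  "sol_mult p q v = q + vector [v$1, exp (p * q$1) * (cos (q$1) * v$2 - sin (q$1) * v$3),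
     exp (p * q$1) * (sin (q$1) * v$2 + cos (q$1) * v$3)]"
  by (simp add: sol_mult_def matrix_exp_sol_A complex_matrix_def matrix_vector_mult_def sum_2
      vec_eq_iff forall_3 Let_def algebra_simps)

text \<open>Left translation is affine in the second factor, so its differential at the identity is
  its linear part: trivial on the first axis, exp (p x) times the rotation by x on the plane of the
  other two.\<close>

lemma sol_e_eq:
  "sol_e p i q = vector [axis i 1 $ 1,
     exp (p * q$1) * (cos (q$1) * axis i 1 $ 2 - sin (q$1) * axis i 1 $ 3),
     exp (p * q$1) * (sin (q$1) * axis i 1 $ 2 + cos (q$1) * axis i 1 $ 3)]"
proof -
  define L where "L = (\<lambda>v::real^3. vector [v$1,
     exp (p * q$1) * (cos (q$1) * v$2 - sin (q$1) * v$3),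
     exp (p * q$1) * (sin (q$1) * v$2 + cos (q$1) * v$3)] :: real^3)"
  have "bounded_linear L"
    unfolding linear_conv_bounded_linear[symmetric] L_def
    by (rule linearI) (simp_all add: vec_eq_iff forall_3 algebra_simps)
  then have "((\<lambda>v. q + L v) has_derivative L) (at 0)"
    by (auto intro!: derivative_eq_intros bounded_linear_imp_has_derivative)
  moreover have "sol_mult p q = (\<lambda>v. q + L v)"
    by (simp add: fun_eq_iff sol_mult_eq L_def)
  ultimately have "frechet_derivative (sol_mult p q) (at 0) = L"
    using frechet_derivative_at by metis
  then show ?thesis by (simp add: sol_e_def L_def)
qed

lemma sol_coframe_eq:
  "sol_coframe p i q v = (vector [v$1, exp (- (p * q$1)) * (cos (q$1) * v$2 + sin (q$1) * v$3),
     exp (- (p * q$1)) * (cos (q$1) * v$3 - sin (q$1) * v$2)] :: real^3) $ i"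
proof -
  \<comment> \<open>The inverse of the frame matrix: rotation by minus the first coordinate, scaled
    by exp (- p x).\<close>
  define N :: "real^3^3" where "N = vector [vector [1, 0, 0],
     vector [0, exp (- (p * q$1)) * cos (q$1), exp (- (p * q$1)) * sin (q$1)],
     vector [0, - exp (- (p * q$1)) * sin (q$1), exp (- (p * q$1)) * cos (q$1)]]"
  define c s where "c = cos (q$1)" and "s = sin (q$1)"
  have cs: "c * c + s * s = 1" "s * s + c * c = 1" by (simp_all add: c_def s_def flip: power2_eq_square)
  \<comment> \<open>Naming sine, cosine and the exponentials reduces the matrix identity to
    polynomial ones modulo c^2 + s^2 = 1 and a b = 1.\<close>
  define a b where "a = exp (p * q$1)" and "b = exp (- (p * q$1))"
  have ab: "a * b = 1" by (simp add: a_def b_def flip: exp_add)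
  have "(\<chi> k j. sol_e p j q $ k) ** N = mat 1"
    unfolding N_def c_def[symmetric] s_def[symmetric] a_def[symmetric] b_def[symmetric] sol_e_eq
    apply (simp add: matrix_matrix_mult_def vec_eq_iff forall_3 sum_3 mat_def axis_def)
    using cs ab by algebra
  then have "matrix_inv (\<chi> k j. sol_e p j q $ k) = N"
    by (rule matrix_inv_eqI)
  then show ?thesis
    using exhaust_3[of i]
    by (auto simp: sol_coframe_def N_def matrix_vector_mult_def sum_3 algebra_simps)
qed

text \<open>The rotation in the coframe preserves the Euclidean product of the last two components
  and drops out; only the scaling remains.\<close>

lemma sol_metric_eq:
  "sol_metric p \<epsilon> \<alpha> q v w =
     \<epsilon>\<^sup>2 * (v$1 * w$1) + \<alpha>\<^sup>2 * exp (- (2 * p * q$1)) * (v$2 * w$2 + v$3 * w$3)"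
proof -
  define c s where "c = cos (q$1)" and "s = sin (q$1)"
  have cs: "c * c + s * s = 1" by (simp add: c_def s_def flip: power2_eq_square)
  have e: "exp (- (2 * p * q$1)) = exp (- (p * q$1)) * exp (- (p * q$1))"
    by (simp flip: exp_add)
  show ?thesis
    unfolding sol_metric_def sol_coframe_eq e vector_3 c_def[symmetric] s_def[symmetric]
    using cs by algebra
qed

section \<open>Christoffel symbols and the geodesic equation\<close>

lemma gram_sol_metric:
  "gram (sol_metric p \<epsilon> \<alpha>) q $ i $ j =
     (if i = j then if i = 1 then \<epsilon>\<^sup>2 else \<alpha>\<^sup>2 * exp (- (2 * p * q$1)) else 0)"
  using exhaust_3[of i] exhaust_3[of j]
  by (auto simp: gram_def sol_metric_eq axis_def)

lemma matrix_inv_gram_sol_metric: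
  assumes "\<epsilon> > 0" "\<alpha> > 0"
  shows "matrix_inv (gram (sol_metric p \<epsilon> \<alpha>) q) $ i $ j =
     (if i = j then if i = 1 then 1 / \<epsilon>\<^sup>2 else exp (2 * p * q$1) / \<alpha>\<^sup>2 else 0)"
proof -
  define N :: "real^3^3" where
    "N = (\<chi> i j. if i = j then if i = 1 then 1 / \<epsilon>\<^sup>2 else exp (2 * p * q$1) / \<alpha>\<^sup>2 else 0)"
  have "gram (sol_metric p \<epsilon> \<alpha>) q ** N = mat 1"
    using assms
    by (simp add: N_def matrix_matrix_mult_def vec_eq_iff forall_3 sum_3 mat_def gram_sol_metric
        flip: exp_add)
  then show ?thesis by (simp add: matrix_inv_eqI N_def)
qed

lemma dgram_sol_metric:
  "dgram (sol_metric p \<epsilon> \<alpha>) l i j q =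
     (if i = j \<and> i \<noteq> 1 \<and> l = 1 then - 2 * p * \<alpha>\<^sup>2 * exp (- (2 * p * q$1)) else 0)"
proof -
  define f where "f = (\<lambda>r. gram (sol_metric p \<epsilon> \<alpha>) r $ i $ j)"
  define f' where "f' = (\<lambda>v::real^3. if i = j \<and> i \<noteq> 1
    then - 2 * p * \<alpha>\<^sup>2 * exp (- (2 * p * q$1)) * v$1 else 0)"
  have "(f has_derivative f') (at q)"
    unfolding f_def f'_def gram_sol_metric
    by (cases "i = j"; cases "i = 1")
       (auto intro!: derivative_eq_intros bounded_linear_imp_has_derivative[OF bounded_linear_vec_nth])
  then have "frechet_derivative f (at q) = f'"
    using frechet_derivative_at by metis
  then show ?thesis
    using exhaust_3[of l] by (auto simp: dgram_def f_def[symmetric] f'_def axis_def)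
qed

lemma christoffel_sol_metric:
  assumes "\<epsilon> > 0" "\<alpha> > 0"
  shows "christoffel (sol_metric p \<epsilon> \<alpha>) k i j q =
     (if k = 1 then if i = j \<and> i \<noteq> 1 then p * \<alpha>\<^sup>2 / \<epsilon>\<^sup>2 * exp (- (2 * p * q$1)) else 0
      else if i = 1 \<and> j = k \<or> j = 1 \<and> i = k then - p else 0)"
proof -
  have "exp (2 * p * q$1) * exp (- (2 * p * q$1)) = 1"
    by (simp flip: exp_add)
  then show ?thesis
    using assms exhaust_3[of k] exhaust_3[of i] exhaust_3[of j]
    by (elim disjE)
       (simp_all add: christoffel_def sum_3 matrix_inv_gram_sol_metric dgram_sol_metric field_simps)
qed

lemma cov_deriv_sol_metric:
  assumes "\<epsilon> > 0" "\<alpha> > 0"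
  shows "cov_deriv (sol_metric p \<epsilon> \<alpha>) c V s =
    (let v = vector_derivative c (at s); a = vector_derivative V (at s); w = V s in vector
      [a$1 + p * \<alpha>\<^sup>2 / \<epsilon>\<^sup>2 * exp (- (2 * p * c s$1)) * (v$2 * w$2 + v$3 * w$3),
       a$2 - p * (v$1 * w$2 + v$2 * w$1), a$3 - p * (v$1 * w$3 + v$3 * w$1)])"
  using assms
  by (simp add: cov_deriv_def Let_def vec_eq_iff forall_3 sum_3 christoffel_sol_metric algebra_simps
      add_divide_distrib)

lemma has_vector_derivative_vec_nth:
  "(f has_vector_derivative d) (at x) \<Longrightarrow> ((\<lambda>x. f x $ i) has_real_derivative d $ i) (at x)"
  unfolding has_real_derivative_iff_has_vector_derivative
  by (rule bounded_linear.has_vector_derivative[OF bounded_linear_vec_nth])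

lemma has_vector_derivative_vector_3:
  assumes "(f has_real_derivative f') (at x)" "(g has_real_derivative g') (at x)"
    "(h has_real_derivative h') (at x)"
  shows "((\<lambda>x. vector [f x, g x, h x] :: real^3) has_vector_derivative vector [f', g', h']) (at x)"
proof -
  have "((\<lambda>x. f x *\<^sub>R axis 1 1 + g x *\<^sub>R axis 2 1 + h x *\<^sub>R axis 3 1 :: real^3) has_vector_derivative
      f' *\<^sub>R axis 1 1 + g' *\<^sub>R axis 2 1 + h' *\<^sub>R axis 3 1) (at x)"
    using assms[unfolded has_real_derivative_iff_has_vector_derivative]
    by (intro has_vector_derivative_add bounded_linear.has_vector_derivative[OF bounded_linear_scaleR_left])
  moreover have "a *\<^sub>R axis 1 1 + b *\<^sub>R axis 2 1 + c *\<^sub>R axis 3 1 = (vector [a, b, c] :: real^3)" for a b c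
    by (simp add: vec_eq_iff forall_3 axis_def)
  ultimately show ?thesis by simp
qed

text \<open>For checking explicit curves, with the velocities supplied as functions. The last two
  equations say that exp (- 2 p x) (y', z') is conserved.\<close>

lemma geodesic_sol_metricI:
  assumes "\<epsilon> > 0" "\<alpha> > 0" "smooth_on UNIV x" "smooth_on UNIV y" "smooth_on UNIV z"
    and "\<And>s. (x has_real_derivative x' s) (at s)" "\<And>s. (y has_real_derivative y' s) (at s)"
      "\<And>s. (z has_real_derivative z' s) (at s)"
    and "\<And>s. (x' has_real_derivative
        - (p * \<alpha>\<^sup>2 / \<epsilon>\<^sup>2 * exp (- (2 * p * x s)) * ((y' s)\<^sup>2 + (z' s)\<^sup>2))) (at s)"
      "\<And>s. (y' has_real_derivative 2 * p * x' s * y' s) (at s)"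
      "\<And>s. (z' has_real_derivative 2 * p * x' s * z' s) (at s)"
  shows "geodesic (sol_metric p \<epsilon> \<alpha>) UNIV (\<lambda>s. vector [x s, y s, z s])"
proof -
  define c where "c = (\<lambda>s. vector [x s, y s, z s] :: real^3)"
  have d: "vector_derivative c (at s) = vector [x' s, y' s, z' s]" for s
    unfolding c_def by (rule vector_derivative_at[OF has_vector_derivative_vector_3[OF assms(6-8)]])
  have d2: "vector_derivative (\<lambda>r. vector [x' r, y' r, z' r] :: real^3) (at s) =
      vector [- (p * \<alpha>\<^sup>2 / \<epsilon>\<^sup>2 * exp (- (2 * p * x s)) * ((y' s)\<^sup>2 + (z' s)\<^sup>2)),
        2 * p * x' s * y' s, 2 * p * x' s * z' s]" for s
    by (rule vector_derivative_at[OF has_vector_derivative_vector_3[OF assms(9-11)]])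
  have "cov_deriv (sol_metric p \<epsilon> \<alpha>) c (\<lambda>r. vector_derivative c (at r)) s = 0" for s
    unfolding cov_deriv_sol_metric[OF assms(1,2)] d d2
    by (simp add: c_def vec_eq_iff forall_3 power2_eq_square algebra_simps add_divide_distrib)
  moreover have "smooth_on UNIV c"
    unfolding c_def using assms(3-5) by (intro smooth_on_vector_3) auto
  ultimately show ?thesis unfolding geodesic_def c_def by simp
qed

lemma geodesic_sol_metricD:
  assumes "\<epsilon> > 0" "\<alpha> > 0" "geodesic (sol_metric p \<epsilon> \<alpha>) UNIV c"
  defines "v \<equiv> \<lambda>s. vector_derivative c (at s)"
  shows "((\<lambda>s. c s $ i) has_real_derivative v s $ i) (at s)"
    and "((\<lambda>s. v s $ 1) has_real_derivative
        - (p * \<alpha>\<^sup>2 / \<epsilon>\<^sup>2 * exp (- (2 * p * c s $ 1)) * ((v s $ 2)\<^sup>2 + (v s $ 3)\<^sup>2))) (at s)"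
    and "((\<lambda>s. v s $ 2) has_real_derivative 2 * p * v s $ 1 * v s $ 2) (at s)"
    and "((\<lambda>s. v s $ 3) has_real_derivative 2 * p * v s $ 1 * v s $ 3) (at s)"
proof -
  have c: "smooth_on UNIV c" and g: "cov_deriv (sol_metric p \<epsilon> \<alpha>) c v s = 0"
    using assms(3) by (auto simp: geodesic_def v_def)
  show "((\<lambda>s. c s $ i) has_real_derivative v s $ i) (at s)"
    unfolding v_def by (intro has_vector_derivative_vec_nth smooth_on_has_vector_derivative[OF c]) simp
  have "smooth_on UNIV v" unfolding v_def by (intro smooth_on_vector_derivative c) simp
  then have d: "((\<lambda>s. v s $ i) has_real_derivative vector_derivative v (at s) $ i) (at s)" for i
    by (intro has_vector_derivative_vec_nth smooth_on_has_vector_derivative[of UNIV]) simp_all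
  have vs: "vector_derivative c (at s) = v s" by (simp add: v_def)
  have "vector_derivative v (at s) $ 1 =
        - (p * \<alpha>\<^sup>2 / \<epsilon>\<^sup>2 * exp (- (2 * p * c s $ 1)) * ((v s $ 2)\<^sup>2 + (v s $ 3)\<^sup>2))"
      "vector_derivative v (at s) $ 2 = 2 * p * v s $ 1 * v s $ 2"
      "vector_derivative v (at s) $ 3 = 2 * p * v s $ 1 * v s $ 3"
    using g unfolding cov_deriv_sol_metric[OF assms(1,2)]
    by (simp_all add: vs Let_def vec_eq_iff forall_3 power2_eq_square algebra_simps)
  then show "((\<lambda>s. v s $ 1) has_real_derivative
        - (p * \<alpha>\<^sup>2 / \<epsilon>\<^sup>2 * exp (- (2 * p * c s $ 1)) * ((v s $ 2)\<^sup>2 + (v s $ 3)\<^sup>2))) (at s)"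
    "((\<lambda>s. v s $ 2) has_real_derivative 2 * p * v s $ 1 * v s $ 2) (at s)"
    "((\<lambda>s. v s $ 3) has_real_derivative 2 * p * v s $ 1 * v s $ 3) (at s)"
    using d[of 1] d[of 2] d[of 3] by simp_all
qed

section \<open>Geodesics and the exponential map\<close>

text \<open>The operator factors as (D + k) (D - k), and each first order factor is solved by an
  integrating factor.\<close>

lemma linear_ode_zero:
  fixes u u' :: "real \<Rightarrow> real"
  assumes u: "\<And>s. (u has_real_derivative u' s) (at s)"
    and u': "\<And>s. (u' has_real_derivative k\<^sup>2 * u s) (at s)"
    and "u 0 = 0" "u' 0 = 0"
  shows "u s = 0"
proof -
  have "((\<lambda>s. (u' s - k * u s) * exp (k * s)) has_real_derivative 0) (at s)" for s
    by (auto intro!: derivative_eq_intros u u' simp: algebra_simps power2_eq_square)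
  from DERIV_isconst_all[OF allI[OF this], of _ 0]
  have "u' s = k * u s" for s using assms(3,4) by simp
  then have "(u has_real_derivative k * u s) (at s)" for s using u[of s] by simp
  then have "((\<lambda>s. u s * exp (- (k * s))) has_real_derivative 0) (at s)" for s
    by (auto intro!: derivative_eq_intros)
  from DERIV_isconst_all[OF allI[OF this], of s 0] show ?thesis using assms(3) by simp
qed

text \<open>The substitution \<open>w = exp (- p x)\<close> linearises the geodesic equation, thanks to
  conservation of energy.\<close>

lemma geodesic_sol_metric_linearised:
  assumes "\<epsilon> > 0" "\<alpha> > 0" "geodesic (sol_metric p \<epsilon> \<alpha>) UNIV c"
  defines "v \<equiv> \<lambda>s. vector_derivative c (at s)"
  defines "w \<equiv> \<lambda>s. exp (- (p * c s $ 1))"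
  shows "(w has_real_derivative - p * v s $ 1 * w s) (at s)"
    and "((\<lambda>s. - p * v s $ 1 * w s) has_real_derivative
      (p / \<epsilon> * sqrt (sol_metric p \<epsilon> \<alpha> (c 0) (v 0) (v 0)))\<^sup>2 * w s) (at s)"
    and "v s $ 2 = v 0 $ 2 * exp (2 * p * (c s $ 1 - c 0 $ 1))"
    and "v s $ 3 = v 0 $ 3 * exp (2 * p * (c s $ 1 - c 0 $ 1))"
proof -
  have vs: "vector_derivative c (at s) = v s" for s by (simp add: v_def)
  note D = geodesic_sol_metricD[OF assms(1-3), unfolded vs]
  define r where "r = p * \<alpha>\<^sup>2 / \<epsilon>\<^sup>2"
  have r: "\<epsilon>\<^sup>2 * r = p * \<alpha>\<^sup>2" using assms(1) by (simp add: r_def)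
  define e where "e = (\<lambda>s. exp (- (2 * p * c s $ 1)))"
  have x: "((\<lambda>s. c s $ 1) has_real_derivative v s $ 1) (at s)" for s by (rule D(1))
  have v1: "((\<lambda>s. v s $ 1) has_real_derivative - (r * e s * ((v s $ 2)\<^sup>2 + (v s $ 3)\<^sup>2))) (at s)" for s
    using D(2)[of s] by (simp add: r_def e_def)
  have v23: "((\<lambda>s. v s $ 2) has_real_derivative 2 * p * v s $ 1 * v s $ 2) (at s)"
    "((\<lambda>s. v s $ 3) has_real_derivative 2 * p * v s $ 1 * v s $ 3) (at s)" for s
    by (rule D)+
  have e: "(e has_real_derivative - 2 * p * v s $ 1 * e s) (at s)" for s
    unfolding e_def by (rule derivative_eq_intros x refl | simp)+
  have w: "(w has_real_derivative - p * v s $ 1 * w s) (at s)" for s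
    unfolding w_def by (rule derivative_eq_intros x refl | simp)+
  then show "(w has_real_derivative - p * v s $ 1 * w s) (at s)" .
  \<comment> \<open>Such a \<open>u\<close> times exp (- 2 p x) is constant; this covers both
    horizontal velocities.\<close>
  have A: "u s = u 0 * exp (2 * p * (c s $ 1 - c 0 $ 1))"
    if u: "\<And>s. (u has_real_derivative 2 * p * v s $ 1 * u s) (at s)" for u :: "real \<Rightarrow> real" and s
  proof -
    have "((\<lambda>s. u s * e s) has_real_derivative 0) (at s)" for s
      by (rule derivative_eq_intros e u refl | simp)+
    from DERIV_isconst_all[OF allI[OF this], of s 0]
    have "u s * e s * exp (2 * p * c s $ 1) = u 0 * e 0 * exp (2 * p * c s $ 1)" by simp
    then show ?thesis
      by (simp add: e_def mult.assoc right_diff_distrib flip: exp_add)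
  qed
  show "v s $ 2 = v 0 $ 2 * exp (2 * p * (c s $ 1 - c 0 $ 1))" using A[OF v23(1)] .
  show "v s $ 3 = v 0 $ 3 * exp (2 * p * (c s $ 1 - c 0 $ 1))" using A[OF v23(2)] .
  \<comment> \<open>\<open>E\<close> is the squared speed; by the geodesic equations the changes of
    its vertical and horizontal parts cancel.\<close>
  define E where "E = (\<lambda>s. \<epsilon>\<^sup>2 * (v s $ 1)\<^sup>2 + \<alpha>\<^sup>2 * e s * ((v s $ 2)\<^sup>2 + (v s $ 3)\<^sup>2))"
  have "(E has_real_derivative \<epsilon>\<^sup>2 * (2 * v s $ 1 * - (r * e s * ((v s $ 2)\<^sup>2 + (v s $ 3)\<^sup>2))) +
      (\<alpha>\<^sup>2 * (- 2 * p * v s $ 1 * e s) * ((v s $ 2)\<^sup>2 + (v s $ 3)\<^sup>2) + \<alpha>\<^sup>2 * e s *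
       (2 * v s $ 2 * (2 * p * v s $ 1 * v s $ 2) + 2 * v s $ 3 * (2 * p * v s $ 1 * v s $ 3)))) (at s)" for s
    unfolding E_def by (rule derivative_eq_intros e v1 v23 refl | simp)+
  moreover have "\<epsilon>\<^sup>2 * (2 * v s $ 1 * - (r * e s * ((v s $ 2)\<^sup>2 + (v s $ 3)\<^sup>2))) +
      (\<alpha>\<^sup>2 * (- 2 * p * v s $ 1 * e s) * ((v s $ 2)\<^sup>2 + (v s $ 3)\<^sup>2) + \<alpha>\<^sup>2 * e s *
       (2 * v s $ 2 * (2 * p * v s $ 1 * v s $ 2) + 2 * v s $ 3 * (2 * p * v s $ 1 * v s $ 3))) = 0" for s
    using r by algebra
  ultimately have "(E has_real_derivative 0) (at s)" for s by simp
  from DERIV_isconst_all[OF allI[OF this], of _ 0]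
  have E: "E s = sol_metric p \<epsilon> \<alpha> (c 0) (v 0) (v 0)" for s
    by (simp add: E_def e_def sol_metric_eq power2_eq_square)
  \<comment> \<open>The energy is nonnegative, so squaring its square root gives it back; the rate
    in the linear equation is p / \<epsilon> times the speed.\<close>
  have "E s \<ge> 0" for s by (simp add: E_def e_def)
  then have "(p / \<epsilon> * sqrt (sol_metric p \<epsilon> \<alpha> (c 0) (v 0) (v 0)))\<^sup>2 = p\<^sup>2 / \<epsilon>\<^sup>2 * E s" for s
    unfolding E[of s, symmetric] by (simp add: power_mult_distrib power_divide)
  moreover have "((\<lambda>s. - p * v s $ 1 * w s) has_real_derivative
      - p * - (r * e s * ((v s $ 2)\<^sup>2 + (v s $ 3)\<^sup>2)) * w s + - p * v s $ 1 * (- p * v s $ 1 * w s)) (at s)"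
    by (rule derivative_eq_intros w v1 refl | simp)+
  \<comment> \<open>Here w'' = (p^2 x'^2 - p x'') w, and inserting x'' turns the bracket into the
    energy up to a constant factor.\<close>
  moreover have "- p * - (r * e s * ((v s $ 2)\<^sup>2 + (v s $ 3)\<^sup>2)) * w s + - p * v s $ 1 * (- p * v s $ 1 * w s)
      = p\<^sup>2 / \<epsilon>\<^sup>2 * E s * w s"
    unfolding r_def E_def using assms(1) by (simp add: field_simps power2_eq_square)
  ultimately show "((\<lambda>s. - p * v s $ 1 * w s) has_real_derivative
      (p / \<epsilon> * sqrt (sol_metric p \<epsilon> \<alpha> (c 0) (v 0) (v 0)))\<^sup>2 * w s) (at s)" by simp
qed

text \<open>Equal initial data give equal energies, so both functions \<open>w\<close> solve the
  same linear equation with the same data and agree. As p is nonzero, this determines the first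
  coordinate; the other velocities are explicit in it and are integrated.\<close>

lemma geodesic_sol_metric_unique:
  assumes "p \<noteq> 0" "\<epsilon> > 0" "\<alpha> > 0"
    and c: "geodesic (sol_metric p \<epsilon> \<alpha>) UNIV c" and d: "geodesic (sol_metric p \<epsilon> \<alpha>) UNIV d"
    and "c 0 = d 0" "vector_derivative c (at 0) = vector_derivative d (at 0)"
  shows "c s = d s"
proof -
  define w where "w = (\<lambda>(c :: real \<Rightarrow> real^3) s. exp (- (p * c s $ 1)))"
  define w' where "w' = (\<lambda>c s. - p * vector_derivative c (at s) $ 1 * w c s)"
  define k where "k = p / \<epsilon> * sqrt (sol_metric p \<epsilon> \<alpha> (c 0) (vector_derivative c (at 0)) (vector_derivative c (at 0)))"
  note lc = geodesic_sol_metric_linearised[OF assms(2,3) c]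
  note ld = geodesic_sol_metric_linearised[OF assms(2,3) d]
  have "((\<lambda>s. w c s - w d s) has_real_derivative w' c s - w' d s) (at s)" for s
    unfolding w_def w'_def by (intro DERIV_diff lc(1) ld(1))
  moreover have "((\<lambda>s. w' c s - w' d s) has_real_derivative k\<^sup>2 * (w c s - w d s)) (at s)" for s
    using DERIV_diff[OF lc(2)[of s] ld(2)[of s]] assms(6,7)
    by (simp add: w_def w'_def k_def right_diff_distrib)
  ultimately have "w c s - w d s = 0" for s
    by (rule linear_ode_zero) (simp_all add: w_def w'_def assms(6,7))
  then have 1: "c s $ 1 = d s $ 1" for s
    using assms(1) by (simp add: w_def)
  have "((\<lambda>s. c s $ i - d s $ i) has_real_derivative 0) (at s)" if "i = 2 \<or> i = 3" for i s
  proof -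
    have "vector_derivative c (at s) $ i = vector_derivative d (at s) $ i"
      using that lc(3,4)[of s] ld(3,4)[of s] by (auto simp: 1 assms(6,7))
    then show ?thesis
      using DERIV_diff[OF geodesic_sol_metricD(1)[OF assms(2,3) c, of i s]
          geodesic_sol_metricD(1)[OF assms(2,3) d, of i s]] by simp
  qed
  then have "c s $ i - d s $ i = c 0 $ i - d 0 $ i" if "i = 2 \<or> i = 3" for i
    using DERIV_isconst_all[of "\<lambda>s. c s $ i - d s $ i" s 0] that by blast
  from this[of 2] this[of 3] show ?thesis
    by (simp add: vec_eq_iff forall_3 1 assms(6))
qed

text \<open>Uniqueness of geodesics discharges the definite description; from here on, exhibiting a
  geodesic computes the exponential map.\<close>

lemma riem_exp_sol_metric:
  assumes "p \<noteq> 0" "\<epsilon> > 0" "\<alpha> > 0" "geodesic (sol_metric p \<epsilon> \<alpha>) UNIV c"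
  shows "riem_exp (sol_metric p \<epsilon> \<alpha>) (c 0) (vector_derivative c (at 0)) = c 1"
  unfolding riem_exp_def
proof (rule the_equality)
  fix w assume "\<exists>d. geodesic (sol_metric p \<epsilon> \<alpha>) UNIV d \<and> d 0 = c 0 \<and>
    vector_derivative d (at 0) = vector_derivative c (at 0) \<and> d 1 = w"
  then obtain d where d: "geodesic (sol_metric p \<epsilon> \<alpha>) UNIV d" "d 0 = c 0"
    "vector_derivative d (at 0) = vector_derivative c (at 0)" "d 1 = w" by blast
  show "w = c 1"
    using geodesic_sol_metric_unique[OF assms(1-3) d(1) assms(4) d(2,3)] d(4) by simp
qed (rule exI[of _ c], simp add: assms(4))

text \<open>\<open>hpoint\<close> describes the geodesics that are not tangent to \<open>u\<^sub>1\<close> (semicircles of the upper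
  half space model), with \<open>w\<close> an affine parameter, \<open>\<phi>\<close> the direction of the vertical plane and
  \<open>(X, Y, Z)\<close> the apex; \<open>hvel\<close> is the velocity when all six quantities vary.\<close>

definition hpoint :: "real \<Rightarrow> real \<Rightarrow> real \<Rightarrow> real \<Rightarrow> real \<Rightarrow> real \<Rightarrow> real \<Rightarrow> real \<Rightarrow> real^3" where
  "hpoint p \<epsilon> \<alpha> X Y Z \<phi> w = vector [X - ln (cosh w) / p,
     Y + \<epsilon> / (p * \<alpha>) * exp (p * X) * tanh w * cos \<phi>, Z + \<epsilon> / (p * \<alpha>) * exp (p * X) * tanh w * sin \<phi>]"

definition hvel :: "real \<Rightarrow> real \<Rightarrow> real \<Rightarrow> real \<Rightarrow> real \<Rightarrow> real \<Rightarrow>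
    real \<Rightarrow> real \<Rightarrow> real \<Rightarrow> real \<Rightarrow> real \<Rightarrow> real^3" where
  "hvel p \<epsilon> \<alpha> X \<phi> w X' Y' Z' \<phi>' w' = vector [X' - tanh w * w' / p,
     Y' + \<epsilon> / (p * \<alpha>) * exp (p * X) *
       ((p * X' * tanh w + (1 - (tanh w)\<^sup>2) * w') * cos \<phi> - tanh w * \<phi>' * sin \<phi>),
     Z' + \<epsilon> / (p * \<alpha>) * exp (p * X) *
       ((p * X' * tanh w + (1 - (tanh w)\<^sup>2) * w') * sin \<phi> + tanh w * \<phi>' * cos \<phi>)]"

lemma tanh_square: "1 - (tanh w)\<^sup>2 = 1 / (cosh w)\<^sup>2" for w :: real
proof -
  have "1 - (tanh w)\<^sup>2 = ((cosh w)\<^sup>2 - (sinh w)\<^sup>2) / (cosh w)\<^sup>2"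
    by (simp add: tanh_def power_divide diff_divide_distrib)
  then show ?thesis by (simp add: hyperbolic_pythagoras)
qed

text \<open>One formula for both partial derivatives of a ruled surface: along a ruling only
  \<open>w\<close> moves, across the rulings all six quantities may.\<close>

lemma hpoint_has_vector_derivative:
  assumes "p \<noteq> 0" "(X has_real_derivative X') (at t)" "(Y has_real_derivative Y') (at t)"
    "(Z has_real_derivative Z') (at t)" "(\<phi> has_real_derivative \<phi>') (at t)"
    "(w has_real_derivative w') (at t)"
  shows "((\<lambda>t. hpoint p \<epsilon> \<alpha> (X t) (Y t) (Z t) (\<phi> t) (w t)) has_vector_derivative
    hvel p \<epsilon> \<alpha> (X t) (\<phi> t) (w t) X' Y' Z' \<phi>' w') (at t)"
proof -
  define K where "K = \<epsilon> / (p * \<alpha>)"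
  define T where "T = (\<lambda>t. tanh (w t))"
  define E where "E = (\<lambda>t. exp (p * X t))"
  have T: "(T has_real_derivative (1 - (T t)\<^sup>2) * w') (at t)"
    unfolding T_def by (auto intro!: derivative_eq_intros assms)
  have E: "(E has_real_derivative E t * (p * X')) (at t)"
    unfolding E_def by (auto intro!: derivative_eq_intros assms)
  have 1: "((\<lambda>t. X t - ln (cosh (w t)) / p) has_real_derivative X' - T t * w' / p) (at t)"
    unfolding T_def by (rule derivative_eq_intros assms refl | simp add: tanh_def)+
  have 2: "((\<lambda>t. Y t + K * E t * T t * cos (\<phi> t)) has_real_derivative
      Y' + K * E t * ((p * X' * T t + (1 - (T t)\<^sup>2) * w') * cos (\<phi> t) - T t * \<phi>' * sin (\<phi> t))) (at t)"
    by (rule derivative_eq_intros assms T E refl | simp add: algebra_simps)+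
  have 3: "((\<lambda>t. Z t + K * E t * T t * sin (\<phi> t)) has_real_derivative
      Z' + K * E t * ((p * X' * T t + (1 - (T t)\<^sup>2) * w') * sin (\<phi> t) + T t * \<phi>' * cos (\<phi> t))) (at t)"
    by (rule derivative_eq_intros assms T E refl | simp add: algebra_simps)+
  show ?thesis
    using has_vector_derivative_vector_3[OF 1 2 3]
    by (simp add: hpoint_def hvel_def K_def T_def E_def)
qed

lemma smooth_on_hpoint:
  assumes "p \<noteq> 0" "\<alpha> \<noteq> 0" "open S" "smooth_on S X" "smooth_on S Y" "smooth_on S Z" "smooth_on S \<phi>" "smooth_on S w"
  shows "smooth_on S (\<lambda>t. hpoint p \<epsilon> \<alpha> (X t) (Y t) (Z t) (\<phi> t) (w t))"
  unfolding hpoint_def using assms by (intro smooth_on_vector_3 smooth_intros) auto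

lemma exp_hpoint: "p \<noteq> 0 \<Longrightarrow> exp (p * hpoint p \<epsilon> \<alpha> X Y Z \<phi> w $ 1) = exp (p * X) / cosh w"
  by (simp add: hpoint_def right_diff_distrib exp_diff)

text \<open>Put T = tanh (a s + b). Then x' = - a T / p, while y' and z' are multiples of 1 - T^2,
  whose logarithmic derivative - 2 a T equals 2 p x'. In the first equation the powers of cosh
  combine to the derivative of T.\<close>

lemma geodesic_hpoint:
  assumes "p \<noteq> 0" "\<epsilon> > 0" "\<alpha> > 0"
  shows "geodesic (sol_metric p \<epsilon> \<alpha>) UNIV (\<lambda>s. hpoint p \<epsilon> \<alpha> X Y Z \<phi> (a * s + b))"
  unfolding hpoint_def
proof (rule geodesic_sol_metricI[OF assms(2,3)])
  define K where "K = \<epsilon> / (p * \<alpha>) * exp (p * X)"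
  define T where "T = (\<lambda>s. tanh (a * s + b))"
  have T: "(T has_real_derivative (1 - (T s)\<^sup>2) * a) (at s)" for s
    unfolding T_def by (auto intro!: derivative_eq_intros)
  show "smooth_on UNIV (\<lambda>s. X - ln (cosh (a * s + b)) / p)"
    "smooth_on UNIV (\<lambda>s. Y + \<epsilon> / (p * \<alpha>) * exp (p * X) * tanh (a * s + b) * cos \<phi>)"
    "smooth_on UNIV (\<lambda>s. Z + \<epsilon> / (p * \<alpha>) * exp (p * X) * tanh (a * s + b) * sin \<phi>)"
    using assms(1,3) by (auto intro!: smooth_intros)
  show "((\<lambda>s. X - ln (cosh (a * s + b)) / p) has_real_derivative - (a * T s / p)) (at s)" for s
    using assms(1) by (auto intro!: derivative_eq_intros simp: T_def tanh_def)
  show "((\<lambda>s. Y + \<epsilon> / (p * \<alpha>) * exp (p * X) * tanh (a * s + b) * cos \<phi>) has_real_derivative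
      K * cos \<phi> * a * (1 - (T s)\<^sup>2)) (at s)"
    "((\<lambda>s. Z + \<epsilon> / (p * \<alpha>) * exp (p * X) * tanh (a * s + b) * sin \<phi>) has_real_derivative
      K * sin \<phi> * a * (1 - (T s)\<^sup>2)) (at s)" for s
    unfolding K_def[symmetric] fun_cong[OF T_def, symmetric] by (auto intro!: derivative_eq_intros T)
  \<comment> \<open>Common form of the last two equations, used with \<open>r\<close> equal to cos
    \<phi> and to sin \<phi>.\<close>
  have "((\<lambda>s. K * r * a * (1 - (T s)\<^sup>2)) has_real_derivative
      2 * p * (- (a * T s / p)) * (K * r * a * (1 - (T s)\<^sup>2))) (at s)" for s r
    using assms(1) by (auto intro!: derivative_eq_intros T)
  then show "((\<lambda>s. K * cos \<phi> * a * (1 - (T s)\<^sup>2)) has_real_derivative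
      2 * p * (- (a * T s / p)) * (K * cos \<phi> * a * (1 - (T s)\<^sup>2))) (at s)"
    "((\<lambda>s. K * sin \<phi> * a * (1 - (T s)\<^sup>2)) has_real_derivative
      2 * p * (- (a * T s / p)) * (K * sin \<phi> * a * (1 - (T s)\<^sup>2))) (at s)" for s by blast+
  have "p * \<alpha>\<^sup>2 / \<epsilon>\<^sup>2 * exp (- (2 * p * (X - ln (cosh (a * s + b)) / p))) *
      ((K * cos \<phi> * a * (1 - (T s)\<^sup>2))\<^sup>2 + (K * sin \<phi> * a * (1 - (T s)\<^sup>2))\<^sup>2)
      = a\<^sup>2 * (1 - (T s)\<^sup>2) / p" for s
  proof -
    define C where "C = cosh (a * s + b)"
    have C: "C > 0" "1 - (T s)\<^sup>2 = 1 / C\<^sup>2" by (simp_all add: C_def T_def tanh_square)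
    have "- (2 * p * (X - ln C / p)) = 2 * ln C - 2 * (p * X)"
      using assms(1) by (simp add: field_simps)
    then have e: "exp (- (2 * p * (X - ln C / p))) = C\<^sup>2 / (exp (p * X))\<^sup>2"
      using C(1) by (simp add: exp_diff exp_double)
    have "(K * cos \<phi> * a * (1 - (T s)\<^sup>2))\<^sup>2 + (K * sin \<phi> * a * (1 - (T s)\<^sup>2))\<^sup>2
        = (K * a * (1 - (T s)\<^sup>2))\<^sup>2 * ((cos \<phi>)\<^sup>2 + (sin \<phi>)\<^sup>2)"
      by algebra
    also have "\<dots> = (K * a * (1 - (T s)\<^sup>2))\<^sup>2" by simp
    finally show ?thesis
      unfolding C_def[symmetric] e C(2) K_def using C(1) assms
      by (simp add: field_simps power2_eq_square)
  qed
  moreover have "((\<lambda>s. - (a * T s / p)) has_real_derivative - (a\<^sup>2 * (1 - (T s)\<^sup>2) / p)) (at s)" for s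
    by (auto intro!: derivative_eq_intros T simp: power2_eq_square assms(1))
  ultimately show "((\<lambda>s. - (a * T s / p)) has_real_derivative
      - (p * \<alpha>\<^sup>2 / \<epsilon>\<^sup>2 * exp (- (2 * p * (X - ln (cosh (a * s + b)) / p))) *
      ((K * cos \<phi> * a * (1 - (T s)\<^sup>2))\<^sup>2 + (K * sin \<phi> * a * (1 - (T s)\<^sup>2))\<^sup>2))) (at s)" for s
    by simp
qed

lemma hvel_scale: "r *\<^sub>R hvel p \<epsilon> \<alpha> X \<phi> w 0 0 0 0 a = hvel p \<epsilon> \<alpha> X \<phi> w 0 0 0 0 (r * a)"
  by (simp add: hvel_def vec_eq_iff forall_3)

text \<open>The exponential map is read off at time 1, so the geodesic used is the one with its
  parameter sped up by \<open>s\<close>.\<close>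

lemma riem_exp_hpoint:
  assumes "p \<noteq> 0" "\<epsilon> > 0" "\<alpha> > 0"
  shows "riem_exp (sol_metric p \<epsilon> \<alpha>) (hpoint p \<epsilon> \<alpha> X Y Z \<phi> b) (s *\<^sub>R hvel p \<epsilon> \<alpha> X \<phi> b 0 0 0 0 a)
    = hpoint p \<epsilon> \<alpha> X Y Z \<phi> (a * s + b)"
proof -
  have "((\<lambda>r. hpoint p \<epsilon> \<alpha> X Y Z \<phi> (s * a * r + b)) has_vector_derivative
      hvel p \<epsilon> \<alpha> X \<phi> (s * a * 0 + b) 0 0 0 0 (s * a)) (at 0)"
    by (rule hpoint_has_vector_derivative[OF assms(1)]) (auto intro!: derivative_eq_intros)
  then show ?thesis
    using riem_exp_sol_metric[OF assms geodesic_hpoint[OF assms, of X Y Z \<phi> "s * a" b]]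
    by (simp add: vector_derivative_at hvel_scale mult.commute)
qed

text \<open>On a vertical line run at constant velocity the horizontal velocity vanishes, and with
  it every term of the geodesic equation.\<close>

lemma riem_exp_tangent:
  assumes "p \<noteq> 0" "\<epsilon> > 0" "\<alpha> > 0" "v$2 = 0" "v$3 = 0"
  shows "riem_exp (sol_metric p \<epsilon> \<alpha>) q (s *\<^sub>R v) = vector [q$1 + s * v$1, q$2, q$3]"
proof -
  define c where "c = (\<lambda>r. vector [q$1 + s * v$1 * r, q$2, q$3] :: real^3)"
  have "geodesic (sol_metric p \<epsilon> \<alpha>) UNIV c"
    unfolding c_def
    by (rule geodesic_sol_metricI[where x' = "\<lambda>_. s * v$1" and y' = "\<lambda>_. 0" and z' = "\<lambda>_. 0"])
       (auto intro!: derivative_eq_intros smooth_intros assms)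
  moreover have "(c has_vector_derivative vector [s * v$1, 0, 0]) (at 0)"
    unfolding c_def by (rule has_vector_derivative_vector_3) (auto intro!: derivative_eq_intros)
  moreover have "vector [s * v$1, 0, 0] = s *\<^sub>R v" "c 0 = q"
    by (simp_all add: c_def vec_eq_iff forall_3 assms)
  ultimately show ?thesis
    using riem_exp_sol_metric[OF assms(1-3), of c] by (simp add: vector_derivative_at c_def)
qed

text \<open>Solves for the geodesic with initial point \<open>q\<close> and initial vector
  \<open>v\<close>. The ratio of vertical to horizontal velocity, in orthonormal units, is - sinh b;
  this gives \<open>b\<close>. Then \<open>X\<close> is the height of the apex, and \<open>a\<close>
  is p / \<epsilon> times the speed when \<rho> is positive. All parameters are explicit, which
  later yields their smoothness in t.\<close>

lemma hpoint_param:
  fixes q v :: "real^3"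
  assumes "p \<noteq> 0" "\<epsilon> > 0" "\<alpha> > 0" "\<rho> \<noteq> 0" "v$2 = \<rho> * cos \<phi>" "v$3 = \<rho> * sin \<phi>"
  defines "b \<equiv> arsinh (- (\<epsilon> * v$1 * exp (p * q$1)) / (\<alpha> * \<rho>))"
  defines "X \<equiv> q$1 + ln (cosh b) / p"
  defines "a \<equiv> p / \<epsilon> * (\<alpha> * \<rho> * exp (- (p * q$1)) * cosh b)"
  shows "hpoint p \<epsilon> \<alpha> X (q$2 - \<epsilon> / (p * \<alpha>) * exp (p * X) * tanh b * cos \<phi>)
      (q$3 - \<epsilon> / (p * \<alpha>) * exp (p * X) * tanh b * sin \<phi>) \<phi> b = q"
    and "hvel p \<epsilon> \<alpha> X \<phi> b 0 0 0 0 a = v"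
proof -
  show "hpoint p \<epsilon> \<alpha> X (q$2 - \<epsilon> / (p * \<alpha>) * exp (p * X) * tanh b * cos \<phi>)
      (q$3 - \<epsilon> / (p * \<alpha>) * exp (p * X) * tanh b * sin \<phi>) \<phi> b = q"
    by (simp add: hpoint_def X_def vec_eq_iff forall_3)
  have "p * X = p * q$1 + ln (cosh b)" using assms(1) by (simp add: X_def field_simps)
  then have X: "exp (p * X) = exp (p * q$1) * cosh b" by (simp add: exp_add)
  have T: "tanh b * cosh b = - (\<epsilon> * v$1 * exp (p * q$1)) / (\<alpha> * \<rho>)"
    by (simp add: tanh_def b_def sinh_arsinh_real)
  have "hvel p \<epsilon> \<alpha> X \<phi> b 0 0 0 0 a $ 1 = - (\<alpha> * \<rho> * exp (- (p * q$1)) / \<epsilon>) * (tanh b * cosh b)"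
    using assms(1) by (simp add: hvel_def a_def)
  also have "\<dots> = v$1" unfolding T using assms(2-4) by (simp add: exp_minus)
  finally have 1: "hvel p \<epsilon> \<alpha> X \<phi> b 0 0 0 0 a $ 1 = v$1" .
  have "\<epsilon> / (p * \<alpha>) * exp (p * X) * ((1 - (tanh b)\<^sup>2) * a) = \<rho>"
    unfolding X tanh_square a_def using assms(1-4)
    by (simp add: exp_minus power2_eq_square field_simps)
  then have "hvel p \<epsilon> \<alpha> X \<phi> b 0 0 0 0 a $ 2 = v$2" "hvel p \<epsilon> \<alpha> X \<phi> b 0 0 0 0 a $ 3 = v$3"
    by (simp_all add: hvel_def assms(5,6) flip: mult.assoc)
  with 1 show "hvel p \<epsilon> \<alpha> X \<phi> b 0 0 0 0 a = v" by (simp add: vec_eq_iff forall_3)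
qed

text \<open>The \<phi>' part is orthogonal to the vertical plane of the ruling, the X' contributions
  of the vertical and horizontal blocks cancel, and the w' contributions add up by tanh^2 + 1 /
  cosh^2 = 1.\<close>

lemma sol_metric_hvel:
  assumes "p \<noteq> 0" "\<epsilon> > 0" "\<alpha> > 0"
  shows "sol_metric p \<epsilon> \<alpha> (hpoint p \<epsilon> \<alpha> X Y Z \<phi> w)
      (hvel p \<epsilon> \<alpha> X \<phi> w X' Y' Z' \<phi>' w') (hvel p \<epsilon> \<alpha> X \<phi> w 0 0 0 0 a) =
    a * \<epsilon> / p * (\<epsilon> / p * w' + \<alpha> * exp (- (p * X)) * (Y' * cos \<phi> + Z' * sin \<phi>))"
proof -
  define T c s E C where "T = tanh w" and "c = cos \<phi>" and "s = sin \<phi>" and "E = exp (p * X)" and "C = cosh w"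
  have pos: "E > 0" "C > 0" by (simp_all add: E_def C_def)
  have cs: "s\<^sup>2 = 1 - c\<^sup>2" by (simp add: c_def s_def sin_squared_eq)
  have T: "1 - T\<^sup>2 = 1 / C\<^sup>2" by (simp add: T_def C_def tanh_square)
  have "exp (- (2 * p * hpoint p \<epsilon> \<alpha> X Y Z \<phi> w $ 1)) = 1 / (exp (p * hpoint p \<epsilon> \<alpha> X Y Z \<phi> w $ 1))\<^sup>2"
    by (simp add: exp_minus exp_double[symmetric] mult.assoc inverse_eq_divide)
  also have "\<dots> = C\<^sup>2 / E\<^sup>2" by (simp add: exp_hpoint[OF assms(1)] E_def C_def power_divide)
  finally have e: "exp (- (2 * p * hpoint p \<epsilon> \<alpha> X Y Z \<phi> w $ 1)) = C\<^sup>2 / E\<^sup>2" .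
  have "\<epsilon>\<^sup>2 * ((X' - T * w' / p) * (0 - T * a / p)) + \<alpha>\<^sup>2 * (C\<^sup>2 / E\<^sup>2) *
      ((Y' + \<epsilon> / (p * \<alpha>) * E * ((p * X' * T + (1 - T\<^sup>2) * w') * c - T * \<phi>' * s)) * (\<epsilon> / (p * \<alpha>) * E * ((1 - T\<^sup>2) * a * c)) +
      (Z' + \<epsilon> / (p * \<alpha>) * E * ((p * X' * T + (1 - T\<^sup>2) * w') * s + T * \<phi>' * c)) * (\<epsilon> / (p * \<alpha>) * E * ((1 - T\<^sup>2) * a * s)))
    = \<epsilon>\<^sup>2 * ((X' - T * w' / p) * (0 - T * a / p)) + \<alpha> * \<epsilon> * a / (p * E) * (C\<^sup>2 * (1 - T\<^sup>2)) *
      (Y' * c + Z' * s + \<epsilon> / (p * \<alpha>) * E * (p * X' * T + (1 - T\<^sup>2) * w') * (c\<^sup>2 + s\<^sup>2))"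
    using pos assms by (simp add: field_simps power2_eq_square)
  also have "\<dots> = \<epsilon>\<^sup>2 * ((X' - T * w' / p) * (0 - T * a / p)) + \<alpha> * \<epsilon> * a / (p * E) *
      (Y' * c + Z' * s + \<epsilon> / (p * \<alpha>) * E * (p * X' * T + (1 - T\<^sup>2) * w'))"
    using pos by (simp add: T cs)
  also have "\<dots> = a * \<epsilon> / p * (\<epsilon> / p * w' + \<alpha> * (1 / E) * (Y' * c + Z' * s))"
    using pos assms by (simp add: field_simps power2_eq_square)
  finally show ?thesis
    unfolding sol_metric_eq e
    by (simp add: hvel_def T_def[symmetric] c_def[symmetric] s_def[symmetric] E_def[symmetric] exp_minus inverse_eq_divide)
qed

section \<open>Adapted frames of ruled surfaces\<close>

lemma sol_u_1: "sol_u p \<epsilon> \<alpha> 1 q = vector [1 / \<epsilon>, 0, 0]"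
  by (simp add: sol_u_def sol_e_eq vec_eq_iff forall_3 axis_def)

lemma sol_u_23:
  "x *\<^sub>R sol_u p \<epsilon> \<alpha> 2 q + y *\<^sub>R sol_u p \<epsilon> \<alpha> 3 q =
    (exp (p * q$1) / \<alpha>) *\<^sub>R vector [0, x * cos (q$1) - y * sin (q$1), x * sin (q$1) + y * cos (q$1)]"
  by (simp add: sol_u_def sol_e_eq vec_eq_iff forall_3 axis_def algebra_simps
      add_divide_distrib diff_divide_distrib)

text \<open>At \<open>q\<close> the horizontal frame is turned by the first coordinate of
  \<open>q\<close>, which together with \<sigma> adds up to \<theta> + X. So the logarithm in
  \<sigma> only undoes the turning of the frame along a ruling, whose horizontal direction is the
  fixed angle \<theta> + X; \<open>r\<close> and \<tau> are components along and across it.\<close>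

lemma sol_u_23_hpoint:
  fixes p \<epsilon> \<alpha> X Y Z \<theta> w r \<tau> :: real
  assumes "p \<noteq> 0"
  defines "\<sigma> \<equiv> 1 / p * ln (cosh w) + \<theta>"
  defines "q \<equiv> hpoint p \<epsilon> \<alpha> X Y Z (\<theta> + X) w"
  shows "(r * cos \<sigma> - \<tau> * sin \<sigma>) *\<^sub>R sol_u p \<epsilon> \<alpha> 2 q + (\<tau> * cos \<sigma> + r * sin \<sigma>) *\<^sub>R sol_u p \<epsilon> \<alpha> 3 q =
    (exp (p * X) / (\<alpha> * cosh w)) *\<^sub>R
      vector [0, r * cos (\<theta> + X) - \<tau> * sin (\<theta> + X), r * sin (\<theta> + X) + \<tau> * cos (\<theta> + X)]"
proof -
  have "q$1 = \<theta> + X - \<sigma>" by (simp add: q_def hpoint_def \<sigma>_def)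
  then have sum: "\<theta> + X = \<sigma> + q$1" by simp
  have e: "exp (p * q$1) = exp (p * X) / cosh w" unfolding q_def by (rule exp_hpoint[OF assms(1)])
  show ?thesis
    unfolding sol_u_23 sum cos_add sin_add
    by (simp add: e vec_eq_iff forall_3 algebra_simps)
qed

text \<open>Separates the orthogonality condition, affine in s, into its two coefficients.\<close>

lemma open_interval_affine_zero:
  assumes "open_interval S" "\<And>s. s \<in> S \<Longrightarrow> A + s * B = (0 :: real)"
  shows "A = 0" "B = 0"
proof -
  obtain s where s: "s \<in> S" using assms(1) by (auto simp: open_interval_def)
  obtain r where r: "s < r" "r \<in> S"
  proof -
    obtain e where "e > 0" "cball s e \<subseteq> S"
      using open_interval_imp_open[OF assms(1)] s open_contains_cball by meson
    then show thesis using that[of "s + e"] by (auto simp: subset_eq dist_real_def)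
  qed
  have "(r - s) * B = 0" using assms(2)[OF s] assms(2)[OF r(2)] by algebra
  then show "B = 0" using r(1) by simp
  then show "A = 0" using assms(2)[OF s] by simp
qed

section \<open>Derivatives of ruled surfaces and the two normal forms\<close>

lemma d_s_eqI:
  assumes "open S" "s \<in> S" "\<And>r. r \<in> S \<Longrightarrow> F (t, r) = f r" "(f has_vector_derivative d) (at s)"
  shows "d_s F t s = d"
  unfolding d_s_def
  by (rule vector_derivative_at[OF has_vector_derivative_transform_within_open[OF assms(4,1,2)]])
     (simp add: assms(3))

lemma d_t_eqI:
  assumes "open T" "t \<in> T" "\<And>\<tau>. \<tau> \<in> T \<Longrightarrow> F (\<tau>, s) = f \<tau>" "(f has_vector_derivative d) (at t)"
  shows "d_t F t s = d"
  unfolding d_t_def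
  by (rule vector_derivative_at[OF has_vector_derivative_transform_within_open[OF assms(4,1,2)]])
     (simp add: assms(3))

lemma d_s_hpoint:
  assumes "p \<noteq> 0" "open S" "s \<in> S"
    and "\<And>r. r \<in> S \<Longrightarrow> F (t, r) = hpoint p \<epsilon> \<alpha> X Y Z \<phi> (a * r + b)"
  shows "d_s F t s = hvel p \<epsilon> \<alpha> X \<phi> (a * s + b) 0 0 0 0 a"
proof (rule d_s_eqI[where F = F and t = t, OF assms(2-4)])
  show "((\<lambda>r. hpoint p \<epsilon> \<alpha> X Y Z \<phi> (a * r + b)) has_vector_derivative
      hvel p \<epsilon> \<alpha> X \<phi> (a * s + b) 0 0 0 0 a) (at s)"
    by (rule hpoint_has_vector_derivative[OF assms(1)]) (auto intro!: derivative_eq_intros)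
qed

lemma d_t_hpoint:
  assumes "p \<noteq> 0" "open T" "t \<in> T"
    and "\<And>t. t \<in> T \<Longrightarrow> F (t, s) = hpoint p \<epsilon> \<alpha> (X t) (Y t) (Z t) (\<phi> t) (a t * s + b t)"
    and "(X has_real_derivative X') (at t)" "(Y has_real_derivative Y') (at t)"
      "(Z has_real_derivative Z') (at t)" "(\<phi> has_real_derivative \<phi>') (at t)"
      "(a has_real_derivative a') (at t)" "(b has_real_derivative b') (at t)"
  shows "d_t F t s = hvel p \<epsilon> \<alpha> (X t) (\<phi> t) (a t * s + b t) X' Y' Z' \<phi>' (a' * s + b')"
proof (rule d_t_eqI[where F = F and s = s, OF assms(2-4)])
  have "((\<lambda>t. a t * s + b t) has_real_derivative a' * s + b') (at t)"
    by (auto intro!: derivative_eq_intros assms(9,10))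
  then show "((\<lambda>t. hpoint p \<epsilon> \<alpha> (X t) (Y t) (Z t) (\<phi> t) (a t * s + b t)) has_vector_derivative
      hvel p \<epsilon> \<alpha> (X t) (\<phi> t) (a t * s + b t) X' Y' Z' \<phi>' (a' * s + b')) (at t)"
    by (rule hpoint_has_vector_derivative[OF assms(1,5-8)])
qed

text \<open>Common end of both directions: the parameters may come from a given surface or from
  integration. The component of (Y', Z') along the angle \<theta> + X is the one that orthogonality
  forces; the component across it carries the free function \<open>b1\<close>.\<close>

lemma frame_form2I:
  fixes X Y Z \<theta> c1 b1 b2 :: "real \<Rightarrow> real"
  assumes "p \<noteq> 0" "\<epsilon> > 0" "\<alpha> > 0" "open T" "open S"
    and F: "\<And>t s. t \<in> T \<Longrightarrow> s \<in> S \<Longrightarrow>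
      F (t, s) = hpoint p \<epsilon> \<alpha> (X t) (Y t) (Z t) (\<theta> t + X t) (p / \<epsilon> * s + c1 t)"
    and c1: "smooth_on T c1" and \<theta>: "smooth_on T \<theta>"
    and X: "\<And>t. t \<in> T \<Longrightarrow> (X has_real_derivative - b2 t / \<epsilon>) (at t)"
    and Y: "\<And>t. t \<in> T \<Longrightarrow> (Y has_real_derivative exp (p * X t) / \<alpha> *
      (- (\<epsilon> / p * deriv c1 t) * cos (\<theta> t + X t) + b1 t * sin (\<theta> t + X t))) (at t)"
    and Z: "\<And>t. t \<in> T \<Longrightarrow> (Z has_real_derivative exp (p * X t) / \<alpha> *
      (- (\<epsilon> / p * deriv c1 t) * sin (\<theta> t + X t) - b1 t * cos (\<theta> t + X t))) (at t)"
  shows "frame_form2 p \<epsilon> \<alpha> T S F c1 \<theta> b1 b2"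
    and "\<And>t s. t \<in> T \<Longrightarrow> s \<in> S \<Longrightarrow> sol_metric p \<epsilon> \<alpha> (F (t, s)) (d_t F t s) (d_s F t s) = 0"
proof -
  define Y' where "Y' = (\<lambda>t. exp (p * X t) / \<alpha> *
      (- (\<epsilon> / p * deriv c1 t) * cos (\<theta> t + X t) + b1 t * sin (\<theta> t + X t)))"
  define Z' where "Z' = (\<lambda>t. exp (p * X t) / \<alpha> *
      (- (\<epsilon> / p * deriv c1 t) * sin (\<theta> t + X t) - b1 t * cos (\<theta> t + X t)))"
  have Y: "(Y has_real_derivative Y' t) (at t)" and Z: "(Z has_real_derivative Z' t) (at t)"
    if "t \<in> T" for t
    using Y[OF that] Z[OF that] by (simp_all only: Y'_def Z'_def)
  have ds: "d_s F t s = hvel p \<epsilon> \<alpha> (X t) (\<theta> t + X t) (p / \<epsilon> * s + c1 t) 0 0 0 0 (p / \<epsilon>)"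
    if "t \<in> T" "s \<in> S" for t s
    using d_s_hpoint[where F = F and t = t, OF assms(1,5) that(2) F[OF that(1)]] .
  have dt: "d_t F t s = hvel p \<epsilon> \<alpha> (X t) (\<theta> t + X t) (p / \<epsilon> * s + c1 t)
      (- b2 t / \<epsilon>) (Y' t) (Z' t) (deriv \<theta> t - b2 t / \<epsilon>) (deriv c1 t)" if "t \<in> T" "s \<in> S" for t s
  proof -
    have "((\<lambda>t. \<theta> t + X t) has_real_derivative deriv \<theta> t - b2 t / \<epsilon>) (at t)"
      using DERIV_add[OF smooth_on_has_real_derivative[OF \<theta> that(1)] X[OF that(1)]] by simp
    from d_t_hpoint[where F = F and a = "\<lambda>_. p / \<epsilon>", OF assms(1,4) that(1) F[OF _ that(2)] X[OF that(1)] Y[OF that(1)]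
        Z[OF that(1)] this DERIV_const smooth_on_has_real_derivative[OF c1 that(1)]]
    show ?thesis by simp
  qed
  show "sol_metric p \<epsilon> \<alpha> (F (t, s)) (d_t F t s) (d_s F t s) = 0" if "t \<in> T" "s \<in> S" for t s
  proof -
    define c s' where "c = cos (\<theta> t + X t)" and "s' = sin (\<theta> t + X t)"
    have cs: "s'\<^sup>2 = 1 - c\<^sup>2" by (simp add: c_def s'_def sin_squared_eq)
    \<comment> \<open>The part of (Y', Z') along the ruling direction cancels the \<open>c1\<close>
      term in \<open>sol_metric_hvel\<close>.\<close>
    have "Y' t * c + Z' t * s' = exp (p * X t) / \<alpha> * (- (\<epsilon> / p * deriv c1 t) * (c\<^sup>2 + s'\<^sup>2))"
      unfolding Y'_def Z'_def c_def[symmetric] s'_def[symmetric] by algebra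
    also have "\<dots> = exp (p * X t) / \<alpha> * (- (\<epsilon> / p * deriv c1 t))" by (simp add: cs)
    finally have "\<epsilon> / p * deriv c1 t + \<alpha> * exp (- (p * X t)) * (Y' t * c + Z' t * s') = 0"
      using assms(3) by (simp add: exp_minus)
    then show ?thesis
      unfolding dt[OF that] ds[OF that] F[OF that] sol_metric_hvel[OF assms(1-3)]
      by (simp add: c_def s'_def)
  qed
  show "frame_form2 p \<epsilon> \<alpha> T S F c1 \<theta> b1 b2"
    unfolding frame_form2_def Let_def
  proof (intro ballI conjI)
    fix t s assume ts: "t \<in> T" "s \<in> S"
    define w \<sigma> \<phi> c1' \<theta>' where "w = p / \<epsilon> * s + c1 t" and "\<sigma> = 1 / p * ln (cosh w) + \<theta> t"
      and "\<phi> = \<theta> t + X t" and "c1' = deriv c1 t" and "\<theta>' = deriv \<theta> t"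
    \<comment> \<open>Components of the t-derivative along and across the horizontal direction of
      the ruling, in orthonormal units; rotating them by \<sigma> gives the frame
      coefficients.\<close>
    define r \<tau> where "r = - b2 t * sinh w - \<epsilon> / p * c1' * sinh w * tanh w"
      and "\<tau> = - b1 t * cosh w + (\<epsilon> * \<theta>' - b2 t) / p * sinh w"
    have C: "cosh w > 0" "sinh w = tanh w * cosh w" by (simp_all add: tanh_def)
    note u23 = sol_u_23_hpoint[OF assms(1), of _ w "\<theta> t" _ \<epsilon> \<alpha> "X t" "Y t" "Z t", folded \<sigma>_def \<phi>_def]
    have Fw: "F (t, s) = hpoint p \<epsilon> \<alpha> (X t) (Y t) (Z t) \<phi> w"
      by (simp add: F[OF ts] w_def \<phi>_def)
    have "d_s F t s = - tanh w *\<^sub>R sol_u p \<epsilon> \<alpha> 1 (F (t, s)) +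
        (exp (p * X t) / (\<alpha> * cosh w)) *\<^sub>R vector [0, sech w * cos \<phi> - 0 * sin \<phi>, sech w * sin \<phi> + 0 * cos \<phi>]"
      unfolding ds[OF ts] sol_u_1 w_def[symmetric] \<phi>_def[symmetric] hvel_def tanh_square
      using assms(1-3) C(1)
      by (simp add: vec_eq_iff forall_3 sech_def field_simps power2_eq_square)
    then show "d_s F t s = - tanh w *\<^sub>R sol_u p \<epsilon> \<alpha> 1 (F (t, s)) +
        (sech w * cos \<sigma>) *\<^sub>R sol_u p \<epsilon> \<alpha> 2 (F (t, s)) + (sech w * sin \<sigma>) *\<^sub>R sol_u p \<epsilon> \<alpha> 3 (F (t, s))"
      unfolding u23[symmetric] Fw by (simp add: add.assoc)
    \<comment> \<open>\<open>hvel\<close> contains only tanh; the division by cosh comes from the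
      scale factor exp (p X) / cosh w of the horizontal frame.\<close>
    have R: "r / cosh w = - b2 t * tanh w - \<epsilon> / p * c1' * (tanh w)\<^sup>2"
        "\<tau> / cosh w = - b1 t + (\<epsilon> * \<theta>' - b2 t) / p * tanh w"
      unfolding r_def \<tau>_def C(2) using C(1) by (simp_all add: diff_divide_distrib add_divide_distrib power2_eq_square)
    have "d_t F t s = (- b2 t - \<epsilon> / p * c1' * tanh w) *\<^sub>R sol_u p \<epsilon> \<alpha> 1 (F (t, s)) +
        (exp (p * X t) / \<alpha>) *\<^sub>R vector [0, (r / cosh w) * cos \<phi> - (\<tau> / cosh w) * sin \<phi>,
          (r / cosh w) * sin \<phi> + (\<tau> / cosh w) * cos \<phi>]"
      unfolding dt[OF ts] sol_u_1 w_def[symmetric] \<phi>_def[symmetric] c1'_def[symmetric] \<theta>'_def[symmetric]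
        hvel_def Y'_def Z'_def R
      using assms(1-3)
      by (simp add: vec_eq_iff forall_3 field_simps power2_eq_square)
    also have "(exp (p * X t) / \<alpha>) *\<^sub>R vector [0, (r / cosh w) * cos \<phi> - (\<tau> / cosh w) * sin \<phi>,
          (r / cosh w) * sin \<phi> + (\<tau> / cosh w) * cos \<phi>] =
        (exp (p * X t) / (\<alpha> * cosh w)) *\<^sub>R (vector [0, r * cos \<phi> - \<tau> * sin \<phi>, r * sin \<phi> + \<tau> * cos \<phi>] :: real^3)"
      by (simp add: vec_eq_iff forall_3 diff_divide_distrib add_divide_distrib right_diff_distrib
          distrib_left mult.commute)
    finally have "d_t F t s = (- b2 t - \<epsilon> / p * c1' * tanh w) *\<^sub>R sol_u p \<epsilon> \<alpha> 1 (F (t, s)) +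
        (r * cos \<sigma> - \<tau> * sin \<sigma>) *\<^sub>R sol_u p \<epsilon> \<alpha> 2 (F (t, s)) +
        (\<tau> * cos \<sigma> + r * sin \<sigma>) *\<^sub>R sol_u p \<epsilon> \<alpha> 3 (F (t, s))"
      unfolding u23[symmetric] Fw by (simp add: add.assoc)
    moreover have "\<tau> * cos \<sigma> + r * sin \<sigma> =
        \<tau> * cos \<sigma> - (b2 t * sinh w + \<epsilon> / p * c1' * sinh w * tanh w) * sin \<sigma>"
      by (simp add: r_def algebra_simps)
    ultimately show "d_t F t s = (- b2 t - \<epsilon> / p * c1' * tanh w) *\<^sub>R sol_u p \<epsilon> \<alpha> 1 (F (t, s)) +
        ((- b2 t * sinh w - \<epsilon> / p * c1' * sinh w * tanh w) * cos \<sigma>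
          - (- b1 t * cosh w + (\<epsilon> * \<theta>' - b2 t) / p * sinh w) * sin \<sigma>) *\<^sub>R sol_u p \<epsilon> \<alpha> 2 (F (t, s)) +
        ((- b1 t * cosh w + (\<epsilon> * \<theta>' - b2 t) / p * sinh w) * cos \<sigma>
          - (b2 t * sinh w + \<epsilon> / p * c1' * sinh w * tanh w) * sin \<sigma>) *\<^sub>R sol_u p \<epsilon> \<alpha> 3 (F (t, s))"
      unfolding r_def \<tau>_def by simp
  qed
qed

text \<open>In coordinates the t-derivative is constant along each ruling; the exponential factor
  and the rotation in s come from the frame alone, which changes with the first coordinate x + s /
  \<epsilon>.\<close>

lemma frame_form1I:
  fixes Y Z a1 a2 :: "real \<Rightarrow> real"
  assumes "p \<noteq> 0" "\<epsilon> > 0" "\<alpha> > 0" "open T" "open S"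
    and F: "\<And>t s. t \<in> T \<Longrightarrow> s \<in> S \<Longrightarrow> F (t, s) = vector [x + s / \<epsilon>, Y t, Z t]"
    and Y: "\<And>t. t \<in> T \<Longrightarrow> (Y has_real_derivative exp (p * x) / \<alpha> * (a1 t * cos x - a2 t * sin x)) (at t)"
    and Z: "\<And>t. t \<in> T \<Longrightarrow> (Z has_real_derivative exp (p * x) / \<alpha> * (a1 t * sin x + a2 t * cos x)) (at t)"
  shows "frame_form1 p \<epsilon> \<alpha> T S F a1 a2"
    and "\<And>t s. t \<in> T \<Longrightarrow> s \<in> S \<Longrightarrow> sol_metric p \<epsilon> \<alpha> (F (t, s)) (d_t F t s) (d_s F t s) = 0"
proof -
  have ds: "d_s F t s = vector [1 / \<epsilon>, 0, 0]" if "t \<in> T" "s \<in> S" for t s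
    by (rule d_s_eqI[where F = F and t = t, OF assms(5) that(2) F[OF that(1)]], assumption)
       (rule has_vector_derivative_vector_3; use assms(2) in \<open>auto intro!: derivative_eq_intros\<close>)
  have dt: "d_t F t s = vector [0, exp (p * x) / \<alpha> * (a1 t * cos x - a2 t * sin x),
      exp (p * x) / \<alpha> * (a1 t * sin x + a2 t * cos x)]" if "t \<in> T" "s \<in> S" for t s
    by (rule d_t_eqI[where F = F and s = s, OF assms(4) that(1) F[OF _ that(2)]], assumption)
       (rule has_vector_derivative_vector_3[OF DERIV_const Y[OF that(1)] Z[OF that(1)]])
  show "sol_metric p \<epsilon> \<alpha> (F (t, s)) (d_t F t s) (d_s F t s) = 0" if "t \<in> T" "s \<in> S" for t s
    unfolding dt[OF that] ds[OF that] sol_metric_eq by simp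
  show "frame_form1 p \<epsilon> \<alpha> T S F a1 a2"
    unfolding frame_form1_def
  proof (intro ballI conjI)
    fix t s assume ts: "t \<in> T" "s \<in> S"
    show "d_s F t s = sol_u p \<epsilon> \<alpha> 1 (F (t, s))" by (simp add: ds[OF ts] sol_u_1)
    define r where "r = s / \<epsilon>"
    \<comment> \<open>\<open>z\<close> is the first coordinate of the point; writing x as z - r lets
      the addition theorems produce the rotation by \<open>r\<close>.\<close>
    define z where "z = x + r"
    have q: "F (t, s) $ 1 = z" "x = z - r" by (simp_all add: F[OF ts] z_def r_def)
    have e: "exp (p * z) * exp (- (p / \<epsilon>) * s) = exp (p * x)"
      by (simp add: z_def r_def algebra_simps flip: exp_add)
    show "d_t F t s =
       (exp (- (p / \<epsilon>) * s) * (a1 t * cos (s / \<epsilon>) + a2 t * sin (s / \<epsilon>))) *\<^sub>R sol_u p \<epsilon> \<alpha> 2 (F (t, s)) +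
       (exp (- (p / \<epsilon>) * s) * (a2 t * cos (s / \<epsilon>) - a1 t * sin (s / \<epsilon>))) *\<^sub>R sol_u p \<epsilon> \<alpha> 3 (F (t, s))"
      unfolding sol_u_23 q(1) dt[OF ts] e[symmetric] r_def[symmetric]
      unfolding q(2) cos_diff sin_diff
      by (simp add: vec_eq_iff forall_3 algebra_simps add_divide_distrib diff_divide_distrib)
  qed
qed

section \<open>Orthogonal ruled surfaces\<close>

text \<open>The horizontal velocity is a nonzero factor times the unit vector (cos \<phi>, sin
  \<phi>), since 1 - tanh^2 is positive.\<close>

lemma hvel_23_nonzero:
  assumes "p \<noteq> 0" "\<epsilon> > 0" "\<alpha> > 0" "a \<noteq> 0"
  shows "\<not> (hvel p \<epsilon> \<alpha> X \<phi> w 0 0 0 0 a $ 2 = 0 \<and> hvel p \<epsilon> \<alpha> X \<phi> w 0 0 0 0 a $ 3 = 0)"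
  using assms sin_zero_abs_cos_one[of \<phi>] by (auto simp: hvel_def tanh_square)

lemma smooth_on_fst_compose:
  fixes f :: "real \<Rightarrow> 'b::real_normed_vector"
  assumes "open T" "open S" "smooth_on T f"
  shows "smooth_on (T \<times> S) (\<lambda>x. f (fst x))"
  using assms by (intro smooth_on_compose[OF _ assms(1) _ assms(3)] smooth_on_fst open_Times) auto

lemma open_rescale_dom: "open S \<Longrightarrow> open (rescale_dom k S)"
  using open_vimage[of S "(*) k"] by (simp add: rescale_dom_def vimage_def continuous_intros)

text \<open>The initial vector decides the kind of a ruling: vertical lines stay tangent to the
  first frame vector, the other geodesics never are. So no ruling is of mixed kind, and both kinds
  become conditions on \<open>V\<close>.\<close>

lemma tangent_transverse_rulings:
  assumes "p \<noteq> 0" "\<epsilon> > 0" "\<alpha> > 0" "open_interval S"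
    and F: "\<And>t s. t \<in> T \<Longrightarrow> s \<in> S \<Longrightarrow>
      F (t, s) = riem_exp (sol_metric p \<epsilon> \<alpha>) (\<gamma> t) (s *\<^sub>R V t)"
  shows "tangent_rulings p \<epsilon> \<alpha> T S F = {t\<in>T. V t $ 2 = 0 \<and> V t $ 3 = 0}"
    and "transverse_rulings p \<epsilon> \<alpha> T S F = {t\<in>T. V t $ 2 \<noteq> 0 \<or> V t $ 3 \<noteq> 0}"
proof -
  have o: "open S" and ne: "S \<noteq> {}" using assms(4) by (auto simp: open_interval_def)
  have tan: "d_s F t s \<in> span {sol_u p \<epsilon> \<alpha> 1 (F (t, s))}"
    if "t \<in> T" "s \<in> S" "V t $ 2 = 0 \<and> V t $ 3 = 0" for t s
  proof -
    have Fr: "F (t, r) = vector [\<gamma> t $ 1 + r * V t $ 1, \<gamma> t $ 2, \<gamma> t $ 3]" if "r \<in> S" for r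
      using F[OF \<open>t \<in> T\<close> that] riem_exp_tangent[OF assms(1-3)] \<open>V t $ 2 = 0 \<and> V t $ 3 = 0\<close> by simp
    have "d_s F t s = vector [V t $ 1, 0, 0]"
      by (rule d_s_eqI[where F = F and t = t, OF o that(2) Fr], assumption)
         (rule has_vector_derivative_vector_3; auto intro!: derivative_eq_intros)
    also have "\<dots> = (\<epsilon> * V t $ 1) *\<^sub>R sol_u p \<epsilon> \<alpha> 1 (F (t, s))"
      using assms(2) by (simp add: sol_u_1 vec_eq_iff forall_3)
    finally show ?thesis by (simp add: span_base span_scale)
  qed
  have trans: "d_s F t s \<notin> span {sol_u p \<epsilon> \<alpha> 1 (F (t, s))}"
    if t: "t \<in> T" and s: "s \<in> S" and V: "V t $ 2 \<noteq> 0 \<or> V t $ 3 \<noteq> 0" for t s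
  proof
    assume "d_s F t s \<in> span {sol_u p \<epsilon> \<alpha> 1 (F (t, s))}"
    then have d0: "d_s F t s $ 2 = 0 \<and> d_s F t s $ 3 = 0"
      by (auto simp: span_singleton sol_u_1)
    \<comment> \<open>With \<open>t\<close> fixed, any polar representation will do, whatever the
      sign of \<rho>.\<close>
    obtain \<rho> \<phi> where pol: "V t $ 2 = \<rho> * cos \<phi>" "V t $ 3 = \<rho> * sin \<phi>"
      using polar_Ex[of "V t $ 2" "V t $ 3"] by blast
    then have "\<rho> \<noteq> 0" using V by auto
    note P = hpoint_param[OF assms(1-3) this pol, of "\<gamma> t"]
    define b where "b = arsinh (- (\<epsilon> * V t $ 1 * exp (p * \<gamma> t $ 1)) / (\<alpha> * \<rho>))"
    define X where "X = \<gamma> t $ 1 + ln (cosh b) / p"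
    define a where "a = p / \<epsilon> * (\<alpha> * \<rho> * exp (- (p * \<gamma> t $ 1)) * cosh b)"
    define Y where "Y = \<gamma> t $ 2 - \<epsilon> / (p * \<alpha>) * exp (p * X) * tanh b * cos \<phi>"
    define Z where "Z = \<gamma> t $ 3 - \<epsilon> / (p * \<alpha>) * exp (p * X) * tanh b * sin \<phi>"
    note P = P[folded b_def, folded X_def a_def, folded Y_def Z_def]
    have "F (t, r) = hpoint p \<epsilon> \<alpha> X Y Z \<phi> (a * r + b)" if "r \<in> S" for r
      using F[OF t that] riem_exp_hpoint[OF assms(1-3), of X Y Z \<phi> b r a] by (simp add: P)
    then have "d_s F t s = hvel p \<epsilon> \<alpha> X \<phi> (a * s + b) 0 0 0 0 a"
      by (rule d_s_hpoint[where F = F and t = t, OF assms(1) o s])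
    moreover have "a \<noteq> 0" using assms(1-3) \<open>\<rho> \<noteq> 0\<close> by (simp add: a_def)
    ultimately show False
      using hvel_23_nonzero[OF assms(1-3), of a X \<phi> "a * s + b"] d0 by simp
  qed
  have e: "(\<forall>s\<in>S. d_s F t s \<in> span {sol_u p \<epsilon> \<alpha> 1 (F (t, s))}) \<longleftrightarrow> V t $ 2 = 0 \<and> V t $ 3 = 0"
    "(\<forall>s\<in>S. d_s F t s \<notin> span {sol_u p \<epsilon> \<alpha> 1 (F (t, s))}) \<longleftrightarrow> V t $ 2 \<noteq> 0 \<or> V t $ 3 \<noteq> 0"
    if "t \<in> T" for t
    using tan[OF that] trans[OF that] ne by blast+
  show "tangent_rulings p \<epsilon> \<alpha> T S F = {t\<in>T. V t $ 2 = 0 \<and> V t $ 3 = 0}"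
    "transverse_rulings p \<epsilon> \<alpha> T S F = {t\<in>T. V t $ 2 \<noteq> 0 \<or> V t $ 3 \<noteq> 0}"
    unfolding tangent_rulings_def transverse_rulings_def
    by (rule Collect_cong, rule conj_cong[OF refl], erule e)+
qed

section \<open>From a surface to its normal form\<close>

lemma ex_frame_form1:
  assumes "p \<noteq> 0" "\<epsilon> > 0" "\<alpha> > 0" "open_interval J" "open_interval S"
    and "smooth_on J \<gamma>" "smooth_on J V" "\<And>t. t \<in> J \<Longrightarrow> V t \<noteq> 0"
    and V: "\<And>t. t \<in> J \<Longrightarrow> V t $ 2 = 0 \<and> V t $ 3 = 0"
    and F: "\<And>t s. t \<in> J \<Longrightarrow> s \<in> S \<Longrightarrow>
      F (t, s) = riem_exp (sol_metric p \<epsilon> \<alpha>) (\<gamma> t) (s *\<^sub>R V t)"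
    and orth: "\<And>t s. t \<in> J \<Longrightarrow> s \<in> S \<Longrightarrow>
      sol_metric p \<epsilon> \<alpha> (F (t, s)) (d_t F t s) (d_s F t s) = 0"
  shows "\<exists>k a1 a2. k \<noteq> 0 \<and> smooth_on J a1 \<and> smooth_on J a2 \<and>
    frame_form1 p \<epsilon> \<alpha> J (rescale_dom k S) (rescale k F) a1 a2"
proof -
  have o: "open J" "open S" using assms(4,5) by (auto simp: open_interval_def)
  have V1: "V t $ 1 \<noteq> 0" if "t \<in> J" for t
    using assms(8)[OF that] V[OF that] by (auto simp: vec_eq_iff forall_3)
  define g where "g = (\<lambda>i t. \<gamma> t $ i)"
  define v where "v = (\<lambda>t. V t $ 1)"
  have sm: "smooth_on J (g i)" "smooth_on J v" for i
    unfolding g_def v_def using o(1) assms(6,7) by (auto intro!: smooth_on_nth)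
  have Fe: "F (t, s) = vector [g 1 t + s * v t, g 2 t, g 3 t]" if "t \<in> J" "s \<in> S" for t s
    using F[OF that] riem_exp_tangent[OF assms(1-3)] V[OF that(1)] by (simp add: g_def v_def)
  \<comment> \<open>The rulings are vertical, so orthogonality kills the first component of the
    t-derivative, an affine function of s. Hence all rulings start at the same height with the same
    velocity.\<close>
  have z: "deriv (g 1) t = 0" "deriv v t = 0" if t: "t \<in> J" for t
  proof -
    have "deriv (g 1) t + s * deriv v t = 0" if s: "s \<in> S" for s
    proof -
      have "d_s F t s = vector [v t, 0, 0]"
        by (rule d_s_eqI[where F = F and t = t, OF o(2) s Fe[OF t]], assumption)
           (rule has_vector_derivative_vector_3; auto intro!: derivative_eq_intros)
      moreover have "d_t F t s = vector [deriv (g 1) t + s * deriv v t, deriv (g 2) t, deriv (g 3) t]"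
      proof (rule d_t_eqI[where F = F and s = s, OF o(1) t Fe[OF _ s]], assumption)
        have "((\<lambda>t. g 1 t + s * v t) has_real_derivative deriv (g 1) t + s * deriv v t) (at t)"
          by (auto intro!: derivative_eq_intros smooth_on_has_real_derivative[OF sm(1) t]
              smooth_on_has_real_derivative[OF sm(2) t])
        then show "((\<lambda>t. vector [g 1 t + s * v t, g 2 t, g 3 t] :: real^3) has_vector_derivative
            vector [deriv (g 1) t + s * deriv v t, deriv (g 2) t, deriv (g 3) t]) (at t)"
          by (intro has_vector_derivative_vector_3 smooth_on_has_real_derivative[OF sm(1) t])
      qed
      ultimately show ?thesis
        using orth[OF t s] assms(2) V1[OF t] by (simp add: sol_metric_eq v_def)
    qed
    from open_interval_affine_zero[OF assms(5) this]
    show "deriv (g 1) t = 0" "deriv v t = 0" by blast+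
  qed
  obtain c where c: "c \<in> J" using assms(4) by (auto simp: open_interval_def)
  define x where "x = g 1 c"
  have x: "g 1 t = x" if "t \<in> J" for t
    unfolding x_def
    by (rule open_interval_constant[OF assms(4) _ that c])
       (metis smooth_on_has_real_derivative[OF sm(1)] z(1))
  have vc: "v t = v c" if "t \<in> J" for t
    by (rule open_interval_constant[OF assms(4) _ that c])
       (metis smooth_on_has_real_derivative[OF sm(2)] z(2))
  have v0: "v c \<noteq> 0" using V1[OF c] by (simp add: v_def)
  \<comment> \<open>This factor turns the velocity of the rulings into the first frame vector; it is
    negative if \<open>v c\<close> is.\<close>
  define k where "k = 1 / (\<epsilon> * v c)"
  define K L where "K = exp (p * x) / \<alpha>" and "L = \<alpha> * exp (- (p * x))"
  have KL: "K * L = 1" using assms(3) by (simp add: K_def L_def exp_minus)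
  \<comment> \<open>The derivative of (g 2, g 3) with the rotation and the scaling of the frame at
    height \<open>x\<close> undone.\<close>
  define a1 where "a1 = (\<lambda>t. L * (deriv (g 2) t * cos x + deriv (g 3) t * sin x))"
  define a2 where "a2 = (\<lambda>t. L * (deriv (g 3) t * cos x - deriv (g 2) t * sin x))"
  have cs: "(sin x)\<^sup>2 + (cos x)\<^sup>2 = 1" by simp
  have "frame_form1 p \<epsilon> \<alpha> J (rescale_dom k S) (rescale k F) a1 a2"
  proof (rule frame_form1I[OF assms(1-3) o(1) open_rescale_dom[OF o(2)]])
    show "rescale k F (t, s) = vector [x + s / \<epsilon>, g 2 t, g 3 t]" if "t \<in> J" "s \<in> rescale_dom k S" for t s
      using Fe[of t "k * s"] that x[OF that(1)] vc[OF that(1)] v0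
      by (simp add: rescale_def rescale_dom_def k_def)
    fix t assume t: "t \<in> J"
    have "K * (a1 t * cos x - a2 t * sin x) = deriv (g 2) t"
      "K * (a1 t * sin x + a2 t * cos x) = deriv (g 3) t"
      unfolding a1_def a2_def using KL cs by algebra+
    then show "(g 2 has_real_derivative exp (p * x) / \<alpha> * (a1 t * cos x - a2 t * sin x)) (at t)"
      "(g 3 has_real_derivative exp (p * x) / \<alpha> * (a1 t * sin x + a2 t * cos x)) (at t)"
      using smooth_on_has_real_derivative[OF sm(1) t] by (simp_all add: K_def)
  qed
  moreover have "smooth_on J a1" "smooth_on J a2"
    unfolding a1_def a2_def using o(1) sm(1) by (auto intro!: smooth_intros smooth_on_deriv)
  moreover have "k \<noteq> 0" using assms(2) v0 by (simp add: k_def)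
  ultimately show ?thesis by (intro exI[of _ k] exI[of _ a1] exI[of _ a2]) simp
qed

lemma ex_frame_form2:
  assumes "p \<noteq> 0" "\<epsilon> > 0" "\<alpha> > 0" "open_interval J" "open_interval S"
    and "smooth_on J \<gamma>" "smooth_on J V"
    and V: "\<And>t. t \<in> J \<Longrightarrow> V t $ 2 \<noteq> 0 \<or> V t $ 3 \<noteq> 0"
    and F: "\<And>t s. t \<in> J \<Longrightarrow> s \<in> S \<Longrightarrow>
      F (t, s) = riem_exp (sol_metric p \<epsilon> \<alpha>) (\<gamma> t) (s *\<^sub>R V t)"
    and orth: "\<And>t s. t \<in> J \<Longrightarrow> s \<in> S \<Longrightarrow>
      sol_metric p \<epsilon> \<alpha> (F (t, s)) (d_t F t s) (d_s F t s) = 0"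
  shows "\<exists>k c1 \<theta> b1 b2. k > 0 \<and>
    smooth_on J c1 \<and> smooth_on J \<theta> \<and> smooth_on J b1 \<and> smooth_on J b2 \<and>
    frame_form2 p \<epsilon> \<alpha> J (rescale_dom k S) (rescale k F) c1 \<theta> b1 b2"
proof -
  have o: "open J" "open S" using assms(4,5) by (auto simp: open_interval_def)
  define g where "g = (\<lambda>i t. \<gamma> t $ i)"
  define v where "v = (\<lambda>i t. V t $ i)"
  have sm: "smooth_on J (g i)" "smooth_on J (v i)" for i
    unfolding g_def v_def using o(1) assms(6,7) by (auto intro!: smooth_on_nth)
  have pos: "(v 2 t)\<^sup>2 + (v 3 t)\<^sup>2 > 0" if "t \<in> J" for t
    using V[OF that] by (simp add: v_def sum_power2_gt_zero_iff)
  \<comment> \<open>The horizontal part of \<open>V\<close> vanishes nowhere on \<open>J\<close>, so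
    its direction lifts to a smooth angle on the interval.\<close>
  obtain \<phi> where \<phi>: "smooth_on J \<phi>" and pol: "\<forall>t\<in>J. v 2 t = sqrt ((v 2 t)\<^sup>2 + (v 3 t)\<^sup>2) * cos (\<phi> t) \<and>
      v 3 t = sqrt ((v 2 t)\<^sup>2 + (v 3 t)\<^sup>2) * sin (\<phi> t)"
    using smooth_angle[OF assms(4) sm(2) sm(2) pos] by blast
  define \<rho> where "\<rho> = (\<lambda>t. sqrt ((v 2 t)\<^sup>2 + (v 3 t)\<^sup>2))"
  have \<rho>: "\<rho> t > 0" "V t $ 2 = \<rho> t * cos (\<phi> t)" "V t $ 3 = \<rho> t * sin (\<phi> t)" if "t \<in> J" for t
    using pos[OF that] bspec[OF pol that] by (simp_all add: \<rho>_def v_def)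
  have s\<rho>: "smooth_on J \<rho>" unfolding \<rho>_def using o(1) sm pos by (intro smooth_intros)
  \<comment> \<open>The parameters of \<open>hpoint_param\<close>, now as functions of t; they are
    smooth because \<rho> stays positive.\<close>
  define b where "b = (\<lambda>t. arsinh (- (\<epsilon> * v 1 t * exp (p * g 1 t)) / (\<alpha> * \<rho> t)))"
  define X where "X = (\<lambda>t. g 1 t + ln (cosh (b t)) / p)"
  define a where "a = (\<lambda>t. p / \<epsilon> * (\<alpha> * \<rho> t * exp (- (p * g 1 t)) * cosh (b t)))"
  define Y where "Y = (\<lambda>t. g 2 t - \<epsilon> / (p * \<alpha>) * exp (p * X t) * tanh (b t) * cos (\<phi> t))"
  define Z where "Z = (\<lambda>t. g 3 t - \<epsilon> / (p * \<alpha>) * exp (p * X t) * tanh (b t) * sin (\<phi> t))"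
  have sb: "smooth_on J b"
    unfolding b_def
  proof (intro smooth_on_arsinh smooth_on_divide smooth_on_minus smooth_on_mult smooth_on_exp smooth_on_const o(1) sm s\<rho>)
    show "\<alpha> * \<rho> t \<noteq> 0" if "t \<in> J" for t using \<rho>(1)[OF that] assms(3) by simp
  qed
  have sX: "smooth_on J X"
    unfolding X_def using assms(1)
    by (intro smooth_on_add smooth_on_divide smooth_on_ln smooth_on_cosh smooth_on_const o(1) sm sb) auto
  have sa: "smooth_on J a"
    unfolding a_def
    by (intro smooth_on_mult smooth_on_exp smooth_on_minus smooth_on_cosh smooth_on_const o(1) sm sb s\<rho>)
  have sYZ: "smooth_on J Y" "smooth_on J Z"
    unfolding Y_def Z_def
    by (intro smooth_on_diff smooth_on_mult smooth_on_exp smooth_on_tanh smooth_on_sin smooth_on_cos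
        smooth_on_const o(1) sm sX sb \<phi>)+
  note D = smooth_on_has_real_derivative
  have Fe: "F (t, s) = hpoint p \<epsilon> \<alpha> (X t) (Y t) (Z t) (\<phi> t) (a t * s + b t)"
    if "t \<in> J" "s \<in> S" for t s
  proof -
    have "\<rho> t \<noteq> 0" using \<rho>(1)[OF that(1)] by simp
    note P = hpoint_param[OF assms(1-3) this \<rho>(2,3)[OF that(1)], of "\<gamma> t"]
    have "hpoint p \<epsilon> \<alpha> (X t) (Y t) (Z t) (\<phi> t) (b t) = \<gamma> t"
      "hvel p \<epsilon> \<alpha> (X t) (\<phi> t) (b t) 0 0 0 0 (a t) = V t"
      using P by (simp_all add: X_def Y_def Z_def a_def b_def g_def v_def)
    then show ?thesis
      using F[OF that] riem_exp_hpoint[OF assms(1-3), of "X t" "Y t" "Z t" "\<phi> t" "b t" s "a t"] by simp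
  qed
  have pa: "p * a t > 0" if "t \<in> J" for t
  proof -
    have "p * a t = p\<^sup>2 * (\<alpha> * \<rho> t * exp (- (p * g 1 t)) * cosh (b t)) / \<epsilon>"
      by (simp add: a_def power2_eq_square)
    also have "\<dots> > 0" using assms(1-3) \<rho>(1)[OF that] by simp
    finally show ?thesis .
  qed
  \<comment> \<open>After division by the nonzero factor in \<open>sol_metric_hvel\<close> the
    orthogonality condition is affine in s: the slope gives a' = 0, the constant term ties the
    component of (Y', Z') along \<phi> to b'.\<close>
  have z: "\<epsilon> / p * deriv b t + \<alpha> * exp (- (p * X t)) * (deriv Y t * cos (\<phi> t) + deriv Z t * sin (\<phi> t)) = 0"
    "deriv a t = 0" if t: "t \<in> J" for t
  proof -
    have "(\<epsilon> / p * deriv b t + \<alpha> * exp (- (p * X t)) * (deriv Y t * cos (\<phi> t) + deriv Z t * sin (\<phi> t))) +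
        s * (\<epsilon> / p * deriv a t) = 0" if s: "s \<in> S" for s
    proof -
      have "d_s F t s = hvel p \<epsilon> \<alpha> (X t) (\<phi> t) (a t * s + b t) 0 0 0 0 (a t)"
        using d_s_hpoint[where F = F and t = t, OF assms(1) o(2) s Fe[OF t]] .
      moreover have "d_t F t s = hvel p \<epsilon> \<alpha> (X t) (\<phi> t) (a t * s + b t)
          (deriv X t) (deriv Y t) (deriv Z t) (deriv \<phi> t) (deriv a t * s + deriv b t)"
        using d_t_hpoint[where F = F and s = s, OF assms(1) o(1) t Fe[OF _ s] D[OF sX t] D[OF sYZ(1) t]
            D[OF sYZ(2) t] D[OF \<phi> t] D[OF sa t] D[OF sb t]] .
      ultimately have "a t * \<epsilon> / p * (\<epsilon> / p * (deriv a t * s + deriv b t) +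
          \<alpha> * exp (- (p * X t)) * (deriv Y t * cos (\<phi> t) + deriv Z t * sin (\<phi> t))) = 0"
        using orth[OF t s] Fe[OF t s] sol_metric_hvel[OF assms(1-3)] by simp
      moreover have "a t * \<epsilon> / p \<noteq> 0" using pa[OF t] assms(1,2) by auto
      ultimately have "\<epsilon> / p * (deriv a t * s + deriv b t) +
          \<alpha> * exp (- (p * X t)) * (deriv Y t * cos (\<phi> t) + deriv Z t * sin (\<phi> t)) = 0"
        by (simp only: mult_eq_0_iff) simp
      then show ?thesis by (simp add: algebra_simps)
    qed
    from open_interval_affine_zero[OF assms(5) this]
    show "\<epsilon> / p * deriv b t + \<alpha> * exp (- (p * X t)) * (deriv Y t * cos (\<phi> t) + deriv Z t * sin (\<phi> t)) = 0"
      "deriv a t = 0" using assms(1,2) by auto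
  qed
  obtain c where c: "c \<in> J" using assms(4) by (auto simp: open_interval_def)
  have ac: "a t = a c" if "t \<in> J" for t
  proof (rule open_interval_constant[OF assms(4) _ that c])
    show "(a has_real_derivative 0) (at t)" if "t \<in> J" for t
      using D[OF sa that] z(2)[OF that] by simp
  qed
  \<comment> \<open>Chosen so that \<open>k\<close> times \<open>a c\<close> is p / \<epsilon>, the
    value for unit speed; it is positive because \<open>a\<close> has the sign of p.\<close>
  define k where "k = p / (\<epsilon> * a c)"
  have ac0: "a c \<noteq> 0" using pa[OF c] by auto
  have k: "k > 0"
  proof -
    have "k = p * a c / (\<epsilon> * (a c)\<^sup>2)" using ac0 by (simp add: k_def power2_eq_square)
    also have "\<dots> > 0" using pa[OF c] ac0 assms(2) by simp
    finally show ?thesis .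
  qed
  \<comment> \<open>Subtracting \<open>X\<close> measures the direction of the ruling against the
    frame at the apex. \<open>b2\<close> records the motion of the apex height, and
    \<open>b1\<close> the part of (Y', Z') across the ruling.\<close>
  define \<theta> where "\<theta> = (\<lambda>t. \<phi> t - X t)"
  define b2 where "b2 = (\<lambda>t. - \<epsilon> * deriv X t)"
  define b1 where "b1 = (\<lambda>t. \<alpha> * exp (- (p * X t)) * (deriv Y t * sin (\<phi> t) - deriv Z t * cos (\<phi> t)))"
  have s\<theta>: "smooth_on J \<theta>" unfolding \<theta>_def by (intro smooth_on_diff o(1) \<phi> sX)
  have "smooth_on J b1"
    unfolding b1_def by (intro smooth_on_diff smooth_on_mult smooth_on_exp smooth_on_minus smooth_on_sin smooth_on_cos
        smooth_on_const smooth_on_deriv o(1) sX sYZ \<phi>)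
  moreover have "smooth_on J b2"
    unfolding b2_def by (intro smooth_on_mult smooth_on_const smooth_on_deriv o(1) sX)
  moreover have "frame_form2 p \<epsilon> \<alpha> J (rescale_dom k S) (rescale k F) b \<theta> b1 b2"
  proof (rule frame_form2I[OF assms(1-3) o(1) open_rescale_dom[OF o(2)] _ sb s\<theta>])
    show "rescale k F (t, s) = hpoint p \<epsilon> \<alpha> (X t) (Y t) (Z t) (\<theta> t + X t) (p / \<epsilon> * s + b t)"
      if "t \<in> J" "s \<in> rescale_dom k S" for t s
      using Fe[of t "k * s"] that ac[OF that(1)] ac0
      by (simp add: rescale_def rescale_dom_def k_def \<theta>_def)
    fix t assume t: "t \<in> J"
    show "(X has_real_derivative - b2 t / \<epsilon>) (at t)"
      using D[OF sX t] assms(2) by (simp add: b2_def)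
    define K L where "K = exp (p * X t) / \<alpha>" and "L = \<alpha> * exp (- (p * X t))"
    have KL: "K * L = 1" using assms(3) by (simp add: K_def L_def exp_minus)
    have cs: "(sin (\<phi> t))\<^sup>2 + (cos (\<phi> t))\<^sup>2 = 1" by simp
    define d where "d = \<epsilon> / p * deriv b t"
    have b': "d + L * (deriv Y t * cos (\<phi> t) + deriv Z t * sin (\<phi> t)) = 0"
      using z(1)[OF t] by (simp add: d_def L_def)
    have b1: "b1 t = L * (deriv Y t * sin (\<phi> t) - deriv Z t * cos (\<phi> t))"
      by (simp add: b1_def L_def)
    \<comment> \<open>(Y', Z') is recovered from its components along and across \<phi>.\<close>
    have "K * (- d * cos (\<phi> t) + b1 t * sin (\<phi> t)) = deriv Y t"
      "K * (- d * sin (\<phi> t) - b1 t * cos (\<phi> t)) = deriv Z t"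
      using b' b1 KL cs by algebra+
    then show "(Y has_real_derivative exp (p * X t) / \<alpha> *
        (- (\<epsilon> / p * deriv b t) * cos (\<theta> t + X t) + b1 t * sin (\<theta> t + X t))) (at t)"
      "(Z has_real_derivative exp (p * X t) / \<alpha> *
        (- (\<epsilon> / p * deriv b t) * sin (\<theta> t + X t) - b1 t * cos (\<theta> t + X t))) (at t)"
      using D[OF sYZ(1) t] D[OF sYZ(2) t] by (simp_all add: \<theta>_def K_def d_def)
  qed
  ultimately show ?thesis
    using k sb s\<theta> by (intro exI[of _ k] exI[of _ b] exI[of _ \<theta>] exI[of _ b1] exI[of _ b2]) simp
qed

section \<open>From prescribed functions to a surface\<close>

lemma ex_surface_form1:
  assumes "p \<noteq> 0" "\<epsilon> > 0" "\<alpha> > 0" "open_interval T" "open_interval S"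
    and "smooth_on T a1" "smooth_on T a2"
  shows "\<exists>F. orthogonal_ruled_surface (sol_metric p \<epsilon> \<alpha>) T S F \<and> frame_form1 p \<epsilon> \<alpha> T S F a1 a2"
proof -
  have o: "open T" "open S" using assms(4,5) by (auto simp: open_interval_def)
  have "smooth_on T (\<lambda>t. a1 t / \<alpha>)" "smooth_on T (\<lambda>t. a2 t / \<alpha>)"
    using assms(3,6,7) o(1) by (auto intro!: smooth_on_divide smooth_on_const)
  from this[THEN ex_smooth_antiderivative[OF assms(4)]]
  obtain Y Z where YZ: "smooth_on T Y" "smooth_on T Z"
    "\<forall>t\<in>T. (Y has_real_derivative a1 t / \<alpha>) (at t)" "\<forall>t\<in>T. (Z has_real_derivative a2 t / \<alpha>) (at t)"
    by blast
  \<comment> \<open>At first coordinate 0 the horizontal frame is the standard one divided by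
    \<alpha>, so \<open>a1\<close> and \<open>a2\<close> are simply \<alpha> Y' and \<alpha>
    Z'.\<close>
  define F where "F = (\<lambda>(t, s). vector [s / \<epsilon>, Y t, Z t] :: real^3)"
  have F: "F (t, s) = vector [0 + s / \<epsilon>, Y t, Z t]" for t s by (simp add: F_def)
  have Y: "(Y has_real_derivative exp (p * 0) / \<alpha> * (a1 t * cos 0 - a2 t * sin 0)) (at t)"
    and Z: "(Z has_real_derivative exp (p * 0) / \<alpha> * (a1 t * sin 0 + a2 t * cos 0)) (at t)"
    if "t \<in> T" for t
    using YZ(3,4) that by simp_all
  note I = frame_form1I[where F = F and x = 0 and Y = Y and Z = Z,
      OF assms(1-3) o F Y Z]
  have "smooth_on (T \<times> S) F"
    unfolding F_def split_beta using assms(2) o YZ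
    by (intro smooth_on_vector_3 smooth_on_divide smooth_on_snd smooth_on_const smooth_on_fst_compose open_Times) auto
  \<comment> \<open>The base curve is the value at s = 0 of the formula for \<open>F\<close>,
    whether or not 0 lies in \<open>S\<close>.\<close>
  moreover have "smooth_on T (\<lambda>t. vector [0, Y t, Z t] :: real^3)"
    using o YZ by (intro smooth_on_vector_3 smooth_on_const)
  moreover have "F (t, s) = riem_exp (sol_metric p \<epsilon> \<alpha>) (vector [0, Y t, Z t]) (s *\<^sub>R vector [1 / \<epsilon>, 0, 0])" for t s
    by (simp add: riem_exp_tangent[OF assms(1-3)] F_def)
  moreover have "(vector [1 / \<epsilon>, 0, 0] :: real^3) \<noteq> 0"
    using assms(2) by (auto simp: vec_eq_iff forall_3)
  ultimately have "ruled_surface (sol_metric p \<epsilon> \<alpha>) T S F"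
    unfolding ruled_surface_def using smooth_on_const[OF o(1)]
    by (intro conjI exI[of _ "\<lambda>t. vector [0, Y t, Z t]"] exI[of _ "\<lambda>t. vector [1 / \<epsilon>, 0, 0]"]) auto
  then have "orthogonal_ruled_surface (sol_metric p \<epsilon> \<alpha>) T S F"
    unfolding orthogonal_ruled_surface_def using I(2) by simp
  with I(1) show ?thesis by (intro exI[of _ F] conjI)
qed

lemma ex_surface_form2:
  assumes "p \<noteq> 0" "\<epsilon> > 0" "\<alpha> > 0" "open_interval T" "open_interval S"
    and "smooth_on T c1" "smooth_on T \<theta>" "smooth_on T b1" "smooth_on T b2"
  shows "\<exists>F. orthogonal_ruled_surface (sol_metric p \<epsilon> \<alpha>) T S F \<and> frame_form2 p \<epsilon> \<alpha> T S F c1 \<theta> b1 b2"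
proof -
  have o: "open T" "open S" using assms(4,5) by (auto simp: open_interval_def)
  \<comment> \<open>\<open>X\<close> is integrated first, because Y' and Z' involve it through the
    scale factor and the angle.\<close>
  have "smooth_on T (\<lambda>t. - b2 t / \<epsilon>)"
    using assms(2,9) o(1) by (intro smooth_on_divide smooth_on_const smooth_on_minus) auto
  from ex_smooth_antiderivative[OF assms(4) this]
  obtain X where X: "smooth_on T X" "\<forall>t\<in>T. (X has_real_derivative - b2 t / \<epsilon>) (at t)" by blast
  define \<phi> where "\<phi> = (\<lambda>t. \<theta> t + X t)"
  have \<phi>: "smooth_on T \<phi>" unfolding \<phi>_def by (intro smooth_on_add o assms X)
  have "smooth_on T (\<lambda>t. exp (p * X t) / \<alpha> * (- (\<epsilon> / p * deriv c1 t) * cos (\<phi> t) + b1 t * sin (\<phi> t)))"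
    "smooth_on T (\<lambda>t. exp (p * X t) / \<alpha> * (- (\<epsilon> / p * deriv c1 t) * sin (\<phi> t) - b1 t * cos (\<phi> t)))"
    using assms(3) by (intro smooth_on_mult smooth_on_divide smooth_on_exp smooth_on_add smooth_on_diff
        smooth_on_minus smooth_on_sin smooth_on_cos smooth_on_const smooth_on_deriv o assms(6,8) X \<phi>; simp)+
  from this[THEN ex_smooth_antiderivative[OF assms(4)]]
  obtain Y Z where YZ: "smooth_on T Y" "smooth_on T Z"
    "\<forall>t\<in>T. (Y has_real_derivative exp (p * X t) / \<alpha> *
      (- (\<epsilon> / p * deriv c1 t) * cos (\<phi> t) + b1 t * sin (\<phi> t))) (at t)"
    "\<forall>t\<in>T. (Z has_real_derivative exp (p * X t) / \<alpha> *
      (- (\<epsilon> / p * deriv c1 t) * sin (\<phi> t) - b1 t * cos (\<phi> t))) (at t)"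
    by blast
  define F where "F = (\<lambda>(t, s). hpoint p \<epsilon> \<alpha> (X t) (Y t) (Z t) (\<phi> t) (p / \<epsilon> * s + c1 t))"
  have Fe: "F (t, s) = hpoint p \<epsilon> \<alpha> (X t) (Y t) (Z t) (\<theta> t + X t) (p / \<epsilon> * s + c1 t)" for t s
    by (simp add: F_def \<phi>_def)
  have X': "(X has_real_derivative - b2 t / \<epsilon>) (at t)"
    and Y': "(Y has_real_derivative exp (p * X t) / \<alpha> *
      (- (\<epsilon> / p * deriv c1 t) * cos (\<theta> t + X t) + b1 t * sin (\<theta> t + X t))) (at t)"
    and Z': "(Z has_real_derivative exp (p * X t) / \<alpha> *
      (- (\<epsilon> / p * deriv c1 t) * sin (\<theta> t + X t) - b1 t * cos (\<theta> t + X t))) (at t)"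
    if "t \<in> T" for t
    using that X(2) YZ(3,4) by (simp_all only: \<phi>_def)
  note I = frame_form2I[where F = F and X = X and Y = Y and Z = Z and \<theta> = \<theta>, OF assms(1-3) o Fe assms(6,7) X' Y' Z']
  have "smooth_on (T \<times> S) F"
    unfolding F_def split_beta using assms(1,3) o X YZ \<phi> assms(6)
    by (intro smooth_on_hpoint smooth_on_add smooth_on_mult smooth_on_const smooth_on_snd
        smooth_on_fst_compose open_Times) auto
  moreover have "smooth_on T (\<lambda>t. hpoint p \<epsilon> \<alpha> (X t) (Y t) (Z t) (\<phi> t) (c1 t))"
    using assms(3) by (intro smooth_on_hpoint[OF assms(1) _ o(1) X(1) YZ(1,2) \<phi> assms(6)]) simp
  \<comment> \<open>The initial field of the rulings: the velocity at s = 0 when only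
    \<open>w\<close> moves, at rate p / \<epsilon>.\<close>
  moreover have "smooth_on T (\<lambda>t. hvel p \<epsilon> \<alpha> (X t) (\<phi> t) (c1 t) 0 0 0 0 (p / \<epsilon>))"
    unfolding hvel_def
    by (intro smooth_on_vector_3 smooth_on_add smooth_on_diff smooth_on_mult smooth_on_divide smooth_on_exp
        smooth_on_power smooth_on_tanh smooth_on_sin smooth_on_cos smooth_on_const o X(1) \<phi> assms(1,6))
  moreover have "F (t, s) = riem_exp (sol_metric p \<epsilon> \<alpha>) (hpoint p \<epsilon> \<alpha> (X t) (Y t) (Z t) (\<phi> t) (c1 t))
      (s *\<^sub>R hvel p \<epsilon> \<alpha> (X t) (\<phi> t) (c1 t) 0 0 0 0 (p / \<epsilon>))" for t s
    by (simp add: riem_exp_hpoint[OF assms(1-3)] F_def)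
  moreover have "hvel p \<epsilon> \<alpha> (X t) (\<phi> t) (c1 t) 0 0 0 0 (p / \<epsilon>) \<noteq> 0" for t
    using hvel_23_nonzero[OF assms(1-3), of "p / \<epsilon>" "X t" "\<phi> t" "c1 t"] assms(1,2) by auto
  ultimately have "ruled_surface (sol_metric p \<epsilon> \<alpha>) T S F"
    unfolding ruled_surface_def
    by (intro conjI exI[of _ "\<lambda>t. hpoint p \<epsilon> \<alpha> (X t) (Y t) (Z t) (\<phi> t) (c1 t)"]
        exI[of _ "\<lambda>t. hvel p \<epsilon> \<alpha> (X t) (\<phi> t) (c1 t) 0 0 0 0 (p / \<epsilon>)"]) auto
  then have "orthogonal_ruled_surface (sol_metric p \<epsilon> \<alpha>) T S F"
    unfolding orthogonal_ruled_surface_def using I(2) by simp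
  with I(1) show ?thesis by (intro exI[of _ F] conjI)
qed

text \<open>A point of \<open>T\<close> off the closure has a neighbourhood in \<open>T\<close> that
  avoids \<open>B\<close>; this lies in \<open>A\<close>, so the point would be interior to
  \<open>A\<close>.\<close>

lemma subset_closure_interior_Un:
  assumes "open T" "A \<union> B = T"
  shows "T \<subseteq> closure (interior A \<union> B)"
proof
  fix t assume t: "t \<in> T"
  show "t \<in> closure (interior A \<union> B)"
  proof (rule ccontr)
    define U where "U = T - closure (interior A \<union> B)"
    assume "t \<notin> closure (interior A \<union> B)"
    then have "t \<in> U" using t by (simp add: U_def)
    moreover have "open U" unfolding U_def using assms(1) by blast
    moreover have "U \<subseteq> A" using assms(2) closure_subset[of "interior A \<union> B"] by (auto simp: U_def)
    ultimately have "t \<in> interior A" by (meson interiorI)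
    then show False using \<open>t \<in> U\<close> closure_subset[of "interior A \<union> B"] by (auto simp: U_def)
  qed
qed

text \<open>One surface may carry both kinds of rulings, so the normal forms are claimed on
  intervals of constant kind; by the density clause only a set of parameters without interior
  escapes. The factor \<open>k\<close> normalises the speed. In the first form its sign also fixes
  the orientation; in the second the angle \<theta> absorbs it. The last two clauses make precise
  that the functions in the normal forms are arbitrary.\<close>

theorem theorem3p1:
  fixes p \<epsilon> \<alpha> :: real and T S :: "real set"
  assumes "p \<noteq> 0" "\<epsilon> > 0" "\<alpha> > 0"
    and "open_interval T" "open_interval S"
  shows
    "(\<forall>F. orthogonal_ruled_surface (sol_metric p \<epsilon> \<alpha>) T S F \<longrightarrow>
        tangent_rulings p \<epsilon> \<alpha> T S F \<union> transverse_rulings p \<epsilon> \<alpha> T S F = T \<and>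
        open (transverse_rulings p \<epsilon> \<alpha> T S F) \<and>
        T \<subseteq> closure (interior (tangent_rulings p \<epsilon> \<alpha> T S F) \<union> transverse_rulings p \<epsilon> \<alpha> T S F) \<and>
        (\<forall>J. open_interval J \<and> J \<subseteq> tangent_rulings p \<epsilon> \<alpha> T S F \<longrightarrow>
           (\<exists>k a1 a2. k \<noteq> 0 \<and> smooth_on J a1 \<and> smooth_on J a2 \<and>
              frame_form1 p \<epsilon> \<alpha> J (rescale_dom k S) (rescale k F) a1 a2)) \<and>
        (\<forall>J. open_interval J \<and> J \<subseteq> transverse_rulings p \<epsilon> \<alpha> T S F \<longrightarrow>
           (\<exists>k c1 \<theta> b1 b2. k > 0 \<and>
              smooth_on J c1 \<and> smooth_on J \<theta> \<and> smooth_on J b1 \<and> smooth_on J b2 \<and>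
              frame_form2 p \<epsilon> \<alpha> J (rescale_dom k S) (rescale k F) c1 \<theta> b1 b2)))
   \<and> (\<forall>a1 a2. smooth_on T a1 \<and> smooth_on T a2 \<longrightarrow>
        (\<exists>F. orthogonal_ruled_surface (sol_metric p \<epsilon> \<alpha>) T S F \<and> frame_form1 p \<epsilon> \<alpha> T S F a1 a2))
   \<and> (\<forall>c1 \<theta> b1 b2.
        smooth_on T c1 \<and> smooth_on T \<theta> \<and> smooth_on T b1 \<and> smooth_on T b2 \<longrightarrow>
        (\<exists>F. orthogonal_ruled_surface (sol_metric p \<epsilon> \<alpha>) T S F \<and>
             frame_form2 p \<epsilon> \<alpha> T S F c1 \<theta> b1 b2))"
proof (intro conjI allI impI)
  have o: "open T" "open S" using assms(4,5) by (auto simp: open_interval_def)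
  fix F assume orth: "orthogonal_ruled_surface (sol_metric p \<epsilon> \<alpha>) T S F"
  then obtain \<gamma> V where sm: "smooth_on T \<gamma>" "smooth_on T V" and V: "\<And>t. t \<in> T \<Longrightarrow> V t \<noteq> 0"
    and F: "\<And>t s. t \<in> T \<Longrightarrow> s \<in> S \<Longrightarrow> F (t, s) = riem_exp (sol_metric p \<epsilon> \<alpha>) (\<gamma> t) (s *\<^sub>R V t)"
    unfolding orthogonal_ruled_surface_def ruled_surface_def by blast
  have orth: "sol_metric p \<epsilon> \<alpha> (F (t, s)) (d_t F t s) (d_s F t s) = 0" if "t \<in> T" "s \<in> S" for t s
    using orth that unfolding orthogonal_ruled_surface_def by blast
  have R: "tangent_rulings p \<epsilon> \<alpha> T S F = {t\<in>T. V t $ 2 = 0 \<and> V t $ 3 = 0}"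
    "transverse_rulings p \<epsilon> \<alpha> T S F = {t\<in>T. V t $ 2 \<noteq> 0 \<or> V t $ 3 \<noteq> 0}"
    by (rule tangent_transverse_rulings[OF assms(1-3,5)], rule F; assumption)+
  show U: "tangent_rulings p \<epsilon> \<alpha> T S F \<union> transverse_rulings p \<epsilon> \<alpha> T S F = T"
    unfolding R by blast
  show "open (transverse_rulings p \<epsilon> \<alpha> T S F)"
  proof -
    \<comment> \<open>Transversality is the nonvanishing of one of two continuous functions on the
      open set \<open>T\<close>.\<close>
    have "continuous_on T (\<lambda>t. V t $ i)" for i
      by (intro smooth_on_imp_continuous_on smooth_on_nth o sm)
    then have "open (T \<inter> (\<lambda>t. V t $ i) -` (- {0}))" for i
      using continuous_on_open_vimage[OF o(1)] by (metis Int_commute open_Compl closed_singleton)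
    then have "open ((T \<inter> (\<lambda>t. V t $ 2) -` (- {0})) \<union> (T \<inter> (\<lambda>t. V t $ 3) -` (- {0})))"
      by (intro open_Un)
    moreover have "{t\<in>T. V t $ 2 \<noteq> 0 \<or> V t $ 3 \<noteq> 0} =
        (T \<inter> (\<lambda>t. V t $ 2) -` (- {0})) \<union> (T \<inter> (\<lambda>t. V t $ 3) -` (- {0}))" by auto
    ultimately show ?thesis unfolding R by simp
  qed
  show "T \<subseteq> closure (interior (tangent_rulings p \<epsilon> \<alpha> T S F) \<union> transverse_rulings p \<epsilon> \<alpha> T S F)"
    by (rule subset_closure_interior_Un[OF o(1) U])
  show "\<exists>k a1 a2. k \<noteq> 0 \<and> smooth_on J a1 \<and> smooth_on J a2 \<and>
      frame_form1 p \<epsilon> \<alpha> J (rescale_dom k S) (rescale k F) a1 a2"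
    if J: "open_interval J \<and> J \<subseteq> tangent_rulings p \<epsilon> \<alpha> T S F" for J
  proof (rule ex_frame_form1[OF assms(1-3) conjunct1[OF J] assms(5)])
    have "J \<subseteq> T" using J unfolding R by blast
    then show "smooth_on J \<gamma>" "smooth_on J V" using sm smooth_on_subset by blast+
  qed (use J V F orth in \<open>auto simp: R\<close>)
  show "\<exists>k c1 \<theta> b1 b2. k > 0 \<and>
      smooth_on J c1 \<and> smooth_on J \<theta> \<and> smooth_on J b1 \<and> smooth_on J b2 \<and>
      frame_form2 p \<epsilon> \<alpha> J (rescale_dom k S) (rescale k F) c1 \<theta> b1 b2"
    if J: "open_interval J \<and> J \<subseteq> transverse_rulings p \<epsilon> \<alpha> T S F" for J
  proof (rule ex_frame_form2[OF assms(1-3) conjunct1[OF J] assms(5)])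
    have "J \<subseteq> T" using J unfolding R by blast
    then show "smooth_on J \<gamma>" "smooth_on J V" using sm smooth_on_subset by blast+
  qed (use J F orth in \<open>auto simp: R\<close>)
qed (use ex_surface_form1[OF assms] ex_surface_form2[OF assms] in blast)+

end
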